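(* Let $m\ge1$, $k\in\{1,\dots,m\}$ and let $\lambda\in\mathsf{Sign}_m^+$ satisfy $\lambda_i>\lambda_{i+1}$ for $i=1,\dots,m-1$. Then $$D_m^k\,\mathsf{F}_\lambda(u_1,\dots,u_m)=\mathbf 1_{\{\lambda_m=0,\ \lambda_{m-1}=1,\ \dots,\ \lambda_{m-k+1}=k-1\}}\ \mathsf{F}_\lambda(u_1,\dots,u_m).$$
   Context: $\mathsf{Sign}_m^+$ is the set of integer sequences $\lambda_1\ge\dots\ge\lambda_m\ge0$. The parameters $s,q\in\mathbb{C}$ are generic (in particular $s\ne0$, $s^2\ne1$, $q\neq1$), and the identity is one of rational functions in $u_1,\dots,u_m$. Vertex weights: a vertex configuration $(i_1,j_1;i_2,j_2)$ records the numbers of arrows entering from below, entering from the left, leaving upwards, leaving to the right. For $g\in\mathbb{Z}_{\ge0}$: $w_u(g,0;g,0)=\frac{1-sq^gu}{1-su}$, $w_u(g+1,0;g,1)=\frac{(1-s^2q^g)u}{1-su}$, $w_u(g,1;g,1)=\frac{u-sq^g}{1-su}$, $w_u(g,1;g+1,0)=\frac{1-q^{g+1}}{1-su}$; all other weights are $0$. $\mathsf{F}_\lambda(u_1,\dots,u_m)$ is the sum of $\prod_{i\ge0}\prod_{j=1}^m w_{u_j}(\omega(i,j))$ over all collections $\omega$ of $m$ up-right paths in $\mathbb{Z}_{\ge0}\times\{1,\dots,m\}$ starting with the horizontal edges $(-1,y)\to(0,y)$, $1\le y\le m$, and ending with the vertical edges $(\lambda_i,m)\to(\lambda_i,m+1)$,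 $1\le i\le m$ (vertical edges may be shared, horizontal ones may not). It is a symmetric rational function. Let $F_k(u_1,\dots,u_k)=\mathsf{F}_{(k-1,k-2,\dots,0)}(u_1,\dots,u_k)$ and $F_k(S)=F_k(s,\dots,s)=s^{k(k-1)/2}\left(\frac{1-q}{1-s^2}\right)^{k(k+1)/2}$. For $I=\{i_1,\dots,i_k\}$ write $F_k(u_I)=F_k(u_{i_1},\dots,u_{i_k})$. $T_{u_i,s}$ replaces the variable $u_i$ by $s$: $T_{u_i,s}F(u_1,\dots,u_m)=F(u_1,\dots,u_{i-1},s,u_{i+1},\dots,u_m)$. The operator $D_m^k$ on functions of $m$ variables is $$D_m^k=\sum_{I\subset\{1,\dots,m\},\,|I|=k}\ \prod_{i\in I,\,j\notin I}\frac{u_j-qu_i}{u_j-u_i}\ \prod_{j\notin I}\left(\frac{u_j-s}{u_j-sq}\right)^k\ \frac{F_k(u_I)}{F_k(S)}\ \prod_{i\in I}T_{u_i,s}.$$ *)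

theory Defs
  imports
    Complex_Main
    "HOL-Library.Groups_Big_Fun"
    "HOL-Combinatorics.Permutations"
begin

text \<open>
  Sequences $(x_1, \dots, x_m)$ are functions on \<^typ>\<open>nat\<close> of which only the values on
  \<^term>\<open>{1..m}\<close> matter. Rational functions of $u_1, \dots, u_m$ are treated as functions
  \<^typ>\<open>(nat \<Rightarrow> complex) \<Rightarrow> complex\<close>, meaningful wherever no denominator vanishes.
\<close>

definition Sign_plus :: "nat \<Rightarrow> (nat \<Rightarrow> int) set" where
  "Sign_plus m =
     {lam. (\<forall>i\<in>{1..<m}. lam i \<ge> lam (i + 1)) \<and> (\<forall>i\<in>{1..m}. lam i \<ge> 0)}"

text \<open>Arguments \<open>i1 j1 i2 j2\<close>: arrows entering from below, entering from the left,
  leaving upwards, leaving to the right.\<close>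

definition vertex_weight ::
  "complex \<Rightarrow> complex \<Rightarrow> complex \<Rightarrow> nat \<Rightarrow> nat \<Rightarrow> nat \<Rightarrow> nat \<Rightarrow> complex" where
  "vertex_weight s q u i1 j1 i2 j2 =
     (if j1 = 0 \<and> j2 = 0 \<and> i1 = i2 then (1 - s * q ^ i1 * u) / (1 - s * u)
      else if j1 = 0 \<and> j2 = 1 \<and> i1 = i2 + 1 then ((1 - s\<^sup>2 * q ^ i2) * u) / (1 - s * u)
      else if j1 = 1 \<and> j2 = 1 \<and> i1 = i2 then (u - s * q ^ i1) / (1 - s * u)
      else if j1 = 1 \<and> j2 = 0 \<and> i2 = i1 + 1 then (1 - q ^ (i1 + 1)) / (1 - s * u)
      else 0)"

type_synonym point = "int \<times> int"

definition up_right_step :: "point \<Rightarrow> point \<Rightarrow> bool" where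
  "up_right_step a b \<longleftrightarrow> b = (fst a + 1, snd a) \<or> b = (fst a, snd a + 1)"

text \<open>An up-right path in $\mathbb{Z}_{\ge 0} \times \{1, \dots, m\}$, listed by its vertices,
  together with its incoming edge $(-1,y) \to (0,y)$ and its outgoing edge
  $(l,m) \to (l,m+1)$.\<close>

definition lattice_path :: "nat \<Rightarrow> nat \<Rightarrow> int \<Rightarrow> point list \<Rightarrow> bool" where
  "lattice_path m y l p \<longleftrightarrow>
     (\<exists>r. p = (-1, int y) # r @ [(l, int m + 1)] \<and>
          r \<noteq> [] \<and> hd r = (0, int y) \<and> last r = (l, int m) \<and>
          set r \<subseteq> {0..} \<times> {1..int m} \<and> successively up_right_step p)"

definition path_edges :: "point list \<Rightarrow> (point \<times> point) set" where
  "path_edges p = set (zip p (tl p))"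

text \<open>A collection of paths is recorded by the number of arrows on each edge: two families of
  paths using every edge equally often (for instance after exchanging the tails of two paths at
  a common vertex) are the same collection, and are counted once. The path entering in row
  \<open>y\<close> may leave through any of the prescribed columns, whence the permutation.\<close>

type_synonym arrows = "point \<times> point \<Rightarrow> nat"

definition path_collections :: "nat \<Rightarrow> (nat \<Rightarrow> int) \<Rightarrow> arrows set" where
  "path_collections m lam =
     {\<omega>. (\<exists>P \<sigma>. \<sigma> permutes {1..m} \<and>
                (\<forall>y\<in>{1..m}. lattice_path m y (lam (\<sigma> y)) (P y)) \<and>
                \<omega> = (\<lambda>e. card {y \<in> {1..m}. e \<in> path_edges (P y)})) \<and>
          (\<forall>i j. \<omega> ((i - 1, j), (i, j)) \<le> 1)}"

definition local_weight ::
  "complex \<Rightarrow> complex \<Rightarrow> complex \<Rightarrow> arrows \<Rightarrow> int \<Rightarrow> int \<Rightarrow> complex" where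
  "local_weight s q u \<omega> i j =
     vertex_weight s q u
       (\<omega> ((i, j - 1), (i, j))) (\<omega> ((i - 1, j), (i, j)))
       (\<omega> ((i, j), (i, j + 1))) (\<omega> ((i, j), (i + 1, j)))"

text \<open>The product over all columns is finite in effect: an empty vertex has weight $1$
  when $1 - s u_j \neq 0$, and \<^const>\<open>Prod_any\<close> ignores factors $1$.\<close>

definition F_sf ::
  "complex \<Rightarrow> complex \<Rightarrow> nat \<Rightarrow> (nat \<Rightarrow> int) \<Rightarrow> (nat \<Rightarrow> complex) \<Rightarrow> complex" where
  "F_sf s q m lam u =
     (\<Sum>\<omega>\<in>path_collections m lam.
        Prod_any (\<lambda>i::nat. \<Prod>j\<in>{1..m}. local_weight s q (u j) \<omega> (int i) (int j)))"

definition F_stair :: "complex \<Rightarrow> complex \<Rightarrow> nat \<Rightarrow> (nat \<Rightarrow> complex) \<Rightarrow> complex" where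
  "F_stair s q k v = F_sf s q k (\<lambda>i. int k - int i) v"

text \<open>$u_I = (u_{i_1}, \dots, u_{i_k})$ for $I = \{i_1 < \dots < i_k\}$; the order is
  immaterial where it is used, since \<^const>\<open>F_stair\<close> is symmetric.\<close>

definition restrict_vars :: "nat set \<Rightarrow> (nat \<Rightarrow> complex) \<Rightarrow> nat \<Rightarrow> complex" where
  "restrict_vars I u = (\<lambda>a. u (sorted_list_of_set I ! (a - 1)))"

definition T_op ::
  "complex \<Rightarrow> nat \<Rightarrow> ((nat \<Rightarrow> complex) \<Rightarrow> complex) \<Rightarrow> (nat \<Rightarrow> complex) \<Rightarrow> complex" where
  "T_op s i G = (\<lambda>u. G (u(i := s)))"

text \<open>The composition of the (pairwise commuting) operators \<^const>\<open>T_op\<close> over \<open>I\<close>.\<close>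

definition T_prod ::
  "complex \<Rightarrow> nat set \<Rightarrow> ((nat \<Rightarrow> complex) \<Rightarrow> complex) \<Rightarrow> (nat \<Rightarrow> complex) \<Rightarrow> complex" where
  "T_prod s I G = foldr (T_op s) (sorted_list_of_set I) G"

definition D_op ::
  "complex \<Rightarrow> complex \<Rightarrow> nat \<Rightarrow> nat \<Rightarrow>
   ((nat \<Rightarrow> complex) \<Rightarrow> complex) \<Rightarrow> (nat \<Rightarrow> complex) \<Rightarrow> complex" where
  "D_op s q m k G = (\<lambda>u.
     \<Sum>I | I \<subseteq> {1..m} \<and> card I = k.
       (\<Prod>i\<in>I. \<Prod>j\<in>{1..m} - I. (u j - q * u i) / (u j - u i)) *
       (\<Prod>j\<in>{1..m} - I. ((u j - s) / (u j - s * q)) ^ k) *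
       (F_stair s q k (restrict_vars I u) / F_stair s q k (\<lambda>_. s)) *
       T_prod s I G u)"

end

theory Submission
  imports Defs
begin

text \<open>
  The partition function is read column by column: the vertices of one column turn the bits of the
  \<open>m\<close> horizontal edges entering it into the bits of the edges leaving it. Two neighbouring rows
  with parameters \<open>u \<noteq> v\<close> satisfy exchange relations, which the Yang-Baxter equation carries across
  every column (\<open>exchangeable_column\<close>): two rows that both start with a path may be swapped, and a
  row without a path that lies above a row with one may be moved below it at the price of a second
  term. As an empty bottom row contributes nothing, this has two consequences.

  First, \<open>F_\<lambda>\<close> is symmetric. Second, if exactly one path leaves through column \<open>0\<close>, the row of
  that path is empty from there on, and moving it to the bottom gives (\<open>set_F_split_one\<close>)
  a sum over \<open>i\<close> of \<open>(1-q)/(1-s u_i) \<Prod>_{j\<noteq>i} (u_j-s)/(1-s u_j) (u_j-q u_i)/(u_j-u_i)\<close> times the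
  partition function of the remaining rows and columns. Iterated over \<open>k\<close> columns, for
  \<open>\<lambda> = (\<mu>, k-1, ..., 0)\<close>, this becomes (\<open>set_F_split\<close>)
  a sum over \<open>I\<close> with \<open>|I| = k\<close> of
  \<open>\<Prod>_{i\<in>I,j\<notin>I} (u_j-q u_i)/(u_j-u_i) \<Prod>_{j\<notin>I} ((u_j-s)/(1-s u_j))^k F_k(u_I) F\<close>, where the last
  factor is the partition function of the rows outside \<open>I\<close> in the columns from \<open>k\<close> on.

  On the other side, put the \<open>k\<close> rows whose variables became \<open>s\<close> at the bottom. At \<open>u = s\<close> a path
  cannot cross an empty vertex, since its weight there is \<open>(u-s)/(1-s u)\<close>. Hence the bottom path
  turns up in column \<open>0\<close>: the value is \<open>0\<close> if no path is to leave there, and otherwise all rows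
  above pass it with weight \<open>(u-s q)/(1-s u)\<close>, and the bottom row disappears. Repeating this
  (\<open>occupation_F_s_ones\<close>, \<open>occupation_F_s_vanish\<close>) yields \<open>0\<close> unless \<open>\<lambda>\<close> ends with
  \<open>k-1, ..., 0\<close>, and then \<open>F_k(S) \<Prod>_{j\<notin>I} ((u_j-s q)/(1-s u_j))^k\<close> times the same last factor.
  So the summand of \<open>D_m^k F_\<lambda>\<close> for \<open>I\<close> is the summand for \<open>I\<close> in the expansion of \<open>F_\<lambda>\<close>.

  It remains to identify the sum over families of paths with the column-wise sum (\<open>F_sf_eq\<close>).
  Arrow counts of families of paths are exactly the flows that are conserved at every vertex,
  because paths can be removed from such a flow one by one; and a flow is determined by its
  horizontal edges, which are the bits summed over column by column.
\<close>

section \<open>Exchange relations between rows\<close>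
context fixes s q :: complex
begin

definition row_weight :: "complex \<Rightarrow> nat \<Rightarrow> bool \<Rightarrow> bool \<Rightarrow> complex" where
  "row_weight u g a b =
     vertex_weight s q u g (of_bool a) (g + of_bool a - of_bool b) (of_bool b)"

lemma row_weight_simps:
  "row_weight u g False False = (1 - s * q ^ g * u) / (1 - s * u)"
  "row_weight u 0 False True = 0"
  "row_weight u (Suc g) False True = (1 - s\<^sup>2 * q ^ g) * u / (1 - s * u)"
  "row_weight u g True True = (u - s * q ^ g) / (1 - s * u)"
  "row_weight u g True False = (1 - q ^ (g + 1)) / (1 - s * u)"
  by (simp_all add: row_weight_def vertex_weight_def)

text \<open>Rows are listed from bottom to top, each with its spectral parameter and the number of arrows
  (as a bit) on its horizontal edge at the current column boundary.\<close>
type_synonym rows = "(complex \<times> bool) list"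

text \<open>Here \<open>g\<close> is the number of arrows below the first listed row, \<open>n\<close> the number leaving the column
  at the top, and \<open>K\<close> the weight of everything to the right. Truncated subtraction does no harm:
  where it truncates, no arrow comes in and one goes out, and the vertex weight is \<open>0\<close>.
  Passing \<open>K\<close> as a function makes the column operator linear, so that relations
  satisfied by \<open>K\<close> can be transported through the column.\<close>
fun column :: "rows \<Rightarrow> nat \<Rightarrow> nat \<Rightarrow> (rows \<Rightarrow> complex) \<Rightarrow> complex" where
  "column [] g n K = (if g = n then K [] else 0)"
| "column ((u, a) # R) g n K =
     (\<Sum>b\<in>UNIV. row_weight u g a b *
        column R (g + of_bool a - of_bool b) n (\<lambda>R'. K ((u, b) # R')))"

text \<open>The strip to the right of the current column boundary, with \<open>ns\<close> the numbers of paths that leave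
  through the top of its columns; after the last column no horizontal arrow may be left.\<close>
primrec strip :: "nat list \<Rightarrow> rows \<Rightarrow> complex" where
  "strip [] R = (if \<exists>r\<in>set R. snd r then 0 else 1)"
| "strip (n # ns) R = column R 0 n (strip ns)"

lemma column_diff:
  "column R g n (\<lambda>R'. c * K R' - d * L R') = c * column R g n K - d * column R g n L"
proof (induction R arbitrary: g K L)
  case (Cons r R)
  obtain u a where r: "r = (u, a)" by (cases r)
  show ?case
    by (simp add: r Cons UNIV_bool algebra_simps)
qed auto

lemma column_scale: "column R g n (\<lambda>R'. c * K R') = c * column R g n K"
  using column_diff[of R g n c K 0 K] by simp

text \<open>The three relations form a system that is closed under adding a column. The last
  one, used for \<open>(u, v)\<close> and for \<open>(v, u)\<close>, eliminates the configurations with an empty row on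
  top; this divides by \<open>u - v\<close> only, whereas the usual form of the intertwining relation, which
  interchanges the parameters in every term, would require division by \<open>u - q v\<close>.\<close>
definition exchangeable :: "(rows \<Rightarrow> complex) \<Rightarrow> bool" where
  "exchangeable K \<longleftrightarrow> (\<forall>P R u v. u \<noteq> v \<longrightarrow>
     (\<forall>a. K (P @ (u, a) # (v, a) # R) = K (P @ (v, a) # (u, a) # R)) \<and>
     (u - v) * K (P @ (u, True) # (v, False) # R) =
       (u - q * v) * K (P @ (v, False) # (u, True) # R)
       - (1 - q) * v * K (P @ (u, False) # (v, True) # R))"

lemma exchangeable_Cons: "exchangeable K \<Longrightarrow> exchangeable (\<lambda>R. K (x # R))"
  unfolding exchangeable_def by (metis append_Cons)

text \<open>Numerators of the vertex weights. Every configuration of two rows has the common denominator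
  \<open>(1 - s u) (1 - s v)\<close>, which is symmetric in \<open>u\<close> and \<open>v\<close>; so the exchange relations are polynomial
  identities between numerators.\<close>
definition row_num :: "complex \<Rightarrow> nat \<Rightarrow> bool \<Rightarrow> bool \<Rightarrow> complex" where
  "row_num u g a b =
     (if a then if b then u - s * q ^ g else 1 - q ^ (g + 1)
      else if b then (case g of 0 \<Rightarrow> 0 | Suc h \<Rightarrow> (1 - s\<^sup>2 * q ^ h) * u)
      else 1 - s * q ^ g * u)"

lemma row_weight_eq: "row_weight u g a b = row_num u g a b / (1 - s * u)"
  by (cases a; cases b; cases g) (simp_all add: row_num_def row_weight_simps)

text \<open>The Yang-Baxter equation at one column: \<open>A\<close> and \<open>B\<close> collect what lies above and to the right of
  two rows with parameters \<open>(u, v)\<close> and \<open>(v, u)\<close>, as functions of their two outgoing bits and of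
  the number of arrows leaving them upwards. Each claim, multiplied by \<open>u - v\<close>, is an explicit
  combination of the two hypotheses \<open>e1\<close> and \<open>e2\<close>; the multipliers are the coefficients with which
  the configurations \<open>A True False\<close> and \<open>B True False\<close> enter.\<close>
lemma two_row_exchange:
  fixes A B :: "bool \<Rightarrow> bool \<Rightarrow> nat \<Rightarrow> complex"
  assumes uv: "u \<noteq> v"
    and same: "\<And>a g. A a a g = B a a g"
    and e1: "\<And>g. (u - v) * A True False g = (u - q * v) * B False True g - (1 - q) * v * A False True g"
    and e2: "\<And>g. (v - u) * B True False g = (v - q * u) * A False True g - (1 - q) * u * B False True g"
  defines "W \<equiv> \<lambda>u v A a b g. \<Sum>b1\<in>UNIV. row_num u g a b1 * (\<Sum>b2\<in>UNIV. row_num v (g + of_bool a - of_bool b1) b b2 * A b1 b2 (g + of_bool a - of_bool b1 + of_bool b - of_bool b2))"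
  shows "W u v A a a g = W v u B a a g"
    and "(u - v) * W u v A True False g = (u - q * v) * W v u B False True g - (1 - q) * v * W u v A False True g"
proof -
  have uv': "u - v \<noteq> 0" using uv by auto
  define E1 where "E1 g = (u - v) * A True False g - (u - q * v) * B False True g + (1 - q) * v * A False True g" for g
  define E2 where "E2 g = (v - u) * B True False g - (v - q * u) * A False True g + (1 - q) * u * B False True g" for g
  have E0: "E1 g = 0" "E2 g = 0" for g using e1[of g] e2[of g] by (auto simp: E1_def E2_def)
  show "W u v A a a g = W v u B a a g"
  proof (cases a)
    case True
    have "(u - v) * (W u v A a a g - W v u B a a g) =
       (u - s * q ^ g) * (1 - q * q ^ g) * E1 (Suc g) + (v - s * q ^ g) * (1 - q * q ^ g) * E2 (Suc g)"
      unfolding W_def E1_def E2_def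
      by (simp add: True UNIV_bool row_num_def same algebra_simps del: mult_eq_0_iff)
    then show ?thesis using uv' by (simp add: E0)
  next
    case False
    show ?thesis
    proof (cases g)
      case 0
      then show ?thesis using False by (simp add: W_def row_num_def UNIV_bool same)
    next
      case (Suc h)
      have "(u - v) * (W u v A a a g - W v u B a a g) =
          (1 - s\<^sup>2 * q ^ h) * u * (1 - s * q ^ h * v) * E1 h + (1 - s\<^sup>2 * q ^ h) * v * (1 - s * q ^ h * u) * E2 h"
        unfolding W_def E1_def E2_def
        by (cases h) (simp_all add: False Suc UNIV_bool row_num_def same algebra_simps del: mult_eq_0_iff)
      then show ?thesis using uv' by (simp add: E0)
    qed
  qed
  \<comment> \<open>The weight with which an empty row below an occupied one (with parameters \<open>v\<close> and \<open>u\<close>) turns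
    into the opposite; for the other order of the parameters the factor \<open>v\<close> becomes \<open>u\<close>.\<close>
  define c where "c = (case g of 0 \<Rightarrow> 0 | Suc h \<Rightarrow> (1 - s\<^sup>2 * q ^ h) * v * (1 - q * q ^ h))"
  have "(u - v) * ((u - v) * W u v A True False g - ((u - q * v) * W v u B False True g - (1 - q) * v * W u v A False True g)) = 
     ((u - v) * (u - s * q ^ g) * (1 - s * q ^ g * v) + (1 - q) * u * c) * E1 g + (u - q * v) * c * E2 g"
    unfolding W_def E1_def E2_def c_def
    by (cases g) (simp_all add: UNIV_bool row_num_def same algebra_simps power2_eq_square del: mult_eq_0_iff)
  then show "(u - v) * W u v A True False g = (u - q * v) * W v u B False True g - (1 - q) * v * W u v A False True g"
    using uv' by (simp add: E0)
qed

lemma exchangeableD: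
  assumes "exchangeable K" "u \<noteq> v"
  shows "K (P @ (u, a) # (v, a) # R) = K (P @ (v, a) # (u, a) # R)"
    and "(u - v) * K (P @ (u, True) # (v, False) # R) =
       (u - q * v) * K (P @ (v, False) # (u, True) # R)
       - (1 - q) * v * K (P @ (u, False) # (v, True) # R)"
  using assms unfolding exchangeable_def by blast+

lemma column_two_rows:
  "column ((u, a) # (v, b) # R) g n K = inverse ((1 - s * u) * (1 - s * v)) *
     (\<Sum>b1\<in>UNIV. row_num u g a b1 *
       (\<Sum>b2\<in>UNIV. row_num v (g + of_bool a - of_bool b1) b b2 *
         column R (g + of_bool a - of_bool b1 + of_bool b - of_bool b2) n
           (\<lambda>R'. K ((u, b1) # (v, b2) # R'))))"
  by (simp add: row_weight_eq sum_distrib_left divide_inverse mult_ac)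

text \<open>Rows below the two exchanged ones only change the number of arrows entering from below and
  prepend a row to the argument of \<open>K\<close>; rows above act linearly. So the claim reduces to the
  local identity.\<close>
lemma exchangeable_column:
  assumes "exchangeable K" shows "exchangeable (\<lambda>R. column R g n K)"
proof -
  have 
   "(\<forall>a. column (P @ (u, a) # (v, a) # R) g n K = column (P @ (v, a) # (u, a) # R) g n K) \<and>
     (u - v) * column (P @ (u, True) # (v, False) # R) g n K =
       (u - q * v) * column (P @ (v, False) # (u, True) # R) g n K
       - (1 - q) * v * column (P @ (u, False) # (v, True) # R) g n K" 
     if uv: "u \<noteq> v" for P R u v
    using assms
  proof (induction P arbitrary: g K)
    case Nil
    define A where "A a b h = column R h n (\<lambda>R'. K ((u, a) # (v, b) # R'))" for a b h
    define B where "B a b h = column R h n (\<lambda>R'. K ((v, a) # (u, b) # R'))" for a b h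
    note ex = exchangeableD[where P = "[]", simplified, OF Nil]
    have same: "A a a h = B a a h" for a h
      unfolding A_def B_def by (subst ex(1)[OF uv]) simp
    have *: "(x - y) * column R h n (\<lambda>R'. K ((x, True) # (y, False) # R')) =
       (x - q * y) * column R h n (\<lambda>R'. K ((y, False) # (x, True) # R'))
       - (1 - q) * y * column R h n (\<lambda>R'. K ((x, False) # (y, True) # R'))" if "x \<noteq> y" for x y h
    proof -
      have "(x - y) * column R h n (\<lambda>R'. K ((x, True) # (y, False) # R')) =
          column R h n (\<lambda>R'. (x - q * y) * K ((y, False) # (x, True) # R') -
            (1 - q) * y * K ((x, False) # (y, True) # R'))"
        by (subst column_scale[symmetric], subst ex(2)[OF that]) simp
      then show ?thesis by (simp add: column_diff)
    qed
    note yb = two_row_exchange[of u v A B, OF uv same *[OF uv, folded A_def B_def] *[OF uv[symmetric], folded A_def B_def]]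
    show ?case
    proof (intro conjI allI)
      fix a show "column ([] @ (u, a) # (v, a) # R) g n K = column ([] @ (v, a) # (u, a) # R) g n K"
        unfolding append_Nil column_two_rows A_def[symmetric] B_def[symmetric]
        using yb(1)[of g a] by (simp only: mult.commute)
    next
      show "(u - v) * column ([] @ (u, True) # (v, False) # R) g n K =
       (u - q * v) * column ([] @ (v, False) # (u, True) # R) g n K
       - (1 - q) * v * column ([] @ (u, False) # (v, True) # R) g n K"
        unfolding append_Nil column_two_rows A_def[symmetric] B_def[symmetric] mult.commute[of "1 - s * v"]
        using arg_cong[OF yb(2)[of g], of "\<lambda>x. inverse ((1 - s * u) * (1 - s * v)) * x"]
        by (simp only: right_diff_distrib mult.left_commute)
    qed
  next
    case (Cons x P)
    obtain w a where x: "x = (w, a)" by (cases x)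
    note IH = Cons.IH[OF exchangeable_Cons[OF Cons.prems]]
    show ?case
    proof (intro conjI allI)
      fix b show "column ((x # P) @ (u, b) # (v, b) # R) g n K = column ((x # P) @ (v, b) # (u, b) # R) g n K"
        by (simp add: x IH)
    next
      have IH2: "(u - v) * column (P @ (u, True) # (v, False) # R) g n (\<lambda>R. K (x # R)) =
       (u - q * v) * column (P @ (v, False) # (u, True) # R) g n (\<lambda>R. K (x # R))
       - (1 - q) * v * column (P @ (u, False) # (v, True) # R) g n (\<lambda>R. K (x # R))" for g x
        using IH by blast
      show "(u - v) * column ((x # P) @ (u, True) # (v, False) # R) g n K =
       (u - q * v) * column ((x # P) @ (v, False) # (u, True) # R) g n K
       - (1 - q) * v * column ((x # P) @ (u, False) # (v, True) # R) g n K"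
        by (simp only: x append_Cons column.simps sum_distrib_left sum_subtractf[symmetric]
            mult.left_commute[of _ "row_weight _ _ _ _"] IH2 right_diff_distrib)
    qed
  qed
  then show ?thesis unfolding exchangeable_def by blast
qed

lemma exchangeable_strip: "exchangeable (strip ns)"
proof (induction ns)
  case Nil
  show ?case by (auto simp: exchangeable_def algebra_simps)
next
  case (Cons n ns)
  then show ?case using exchangeable_column[of "strip ns" 0 n] by simp
qed

text \<open>Nothing enters the bottom row from the left or from below, so it stays empty, and an empty vertex
  has weight \<open>1\<close>.\<close>
lemma strip_empty_row:
  assumes "1 - s * u \<noteq> 0" shows "strip ns ((u, False) # R) = strip ns R"
proof (induction ns arbitrary: R)
  case (Cons n ns)
  then show ?case using assms by (simp add: UNIV_bool row_weight_simps)
qed auto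

abbreviation full :: "complex list \<Rightarrow> rows" where "full us \<equiv> map (\<lambda>u. (u, True)) us"

text \<open>The function \<open>F_\<lambda>\<close>, with \<open>\<lambda>\<close> given by the occupation numbers of the columns.\<close>
definition occupation_F :: "nat list \<Rightarrow> complex list \<Rightarrow> complex" where
  "occupation_F ns us = strip ns (full us)"

lemma strip_move: "strip ns (P @ full (xs @ [u]) @ R) = strip ns (P @ full (u # xs) @ R)"
proof (induction xs arbitrary: R rule: rev_induct)
  case (snoc v xs)
  have "strip ns (P @ full ((xs @ [v]) @ [u]) @ R) = strip ns (P @ full (xs @ [u]) @ (v, True) # R)"
    using exchangeableD(1)[OF exchangeable_strip, of v u ns "P @ full xs" True R] by (cases "u = v") auto
  also have "\<dots> = strip ns (P @ full (u # xs @ [v]) @ R)"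
    by (subst snoc.IH) simp
  finally show ?case by simp
qed simp

text \<open>Symmetry of \<open>F_\<lambda>\<close>: neighbouring transpositions of fully occupied rows generate all
  permutations.\<close>
lemma occupation_F_permute:
  assumes "mset us = mset vs" shows "occupation_F ns us = occupation_F ns vs"
proof -
  have "strip ns (P @ full us) = strip ns (P @ full vs)" for P
    using assms
  proof (induction us arbitrary: P vs)
    case (Cons u us)
    from Cons.prems have "u \<in> set vs" by (metis list.set_intros(1) set_mset_mset)
    then obtain xs ys where vs: "vs = xs @ u # ys" by (meson split_list)
    have "mset us = mset (xs @ ys)" using Cons.prems vs by simp
    then have "strip ns ((P @ [(u, True)]) @ full us) = strip ns ((P @ [(u, True)]) @ full (xs @ ys))"
      by (rule Cons.IH)
    also have "\<dots> = strip ns (P @ full (xs @ [u]) @ full ys)"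
      by (subst strip_move) simp
    finally show ?case by (simp add: vs)
  qed simp
  from this[of "[]"] show ?thesis by (simp add: occupation_F_def)
qed

section \<open>Splitting off the first columns\<close>

text \<open>If a path enters every row from the left, the number of arrows in the column can only grow from
  row to row, because an arrow turns right only where none comes from the left.\<close>
lemma column_full_zero: "n < g \<Longrightarrow> column (full us) g n K = 0"
  by (induction us arbitrary: g K) (simp_all add: UNIV_bool)

lemma column_full_pass:
  "column (full us) n n K = (\<Prod>u\<leftarrow>us. (u - s * q ^ n) / (1 - s * u)) * K (full us)"
  by (induction us arbitrary: K)
     (simp_all add: UNIV_bool row_weight_simps column_full_zero)

lemma column_snoc:
  "column (R @ [(u, True)]) g n K =
     row_weight u n True True * column R g n (\<lambda>R'. K (R' @ [(u, True)])) +
     (case n of 0 \<Rightarrow> 0 | Suc n' \<Rightarrow>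
        row_weight u n' True False * column R g n' (\<lambda>R'. K (R' @ [(u, False)])))"
proof (induction R arbitrary: g K)
  case Nil
  show ?case by (cases n) (auto simp: UNIV_bool)
next
  case (Cons x R)
  obtain v a where x: "x = (v, a)" by (cases x)
  show ?case
    by (simp add: x Cons.IH UNIV_bool algebra_simps split: nat.split)
qed

text \<open>Moving the empty row \<open>u\<close> to the bottom. In each step it moves down one place, either with its
  parameter or taking over the parameter of the row that it passes. At the bottom it disappears,
  whence one term for every parameter that may be lost with it.\<close>
lemma empty_row_down:
  assumes "distinct (p @ [u])" "\<And>v. v \<in> set (p @ [u]) \<Longrightarrow> 1 - s * v \<noteq> 0"
  shows "strip ns (full p @ (u, False) # full r) =
     (\<Prod>v\<in>set p. (v - q * u) / (v - u)) * occupation_F ns (p @ r) -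
     (1 - q) * u * (\<Sum>w\<in>set p. (\<Prod>v\<in>set p - {w}. (v - q * w) / (v - w)) / (w - u)
        * occupation_F ns (remove1 w p @ u # r))"
  using assms
proof (induction p arbitrary: u r rule: rev_induct)
  case Nil
  then show ?case by (simp add: strip_empty_row occupation_F_def)
next
  case (snoc v p)
  define P where "P x B = (\<Prod>v\<in>B. (v - q * x) / (v - x))" for x B
  have vp: "v \<notin> set p" "u \<notin> set p" "u \<noteq> v" using snoc.prems(1) by auto
  then have vu: "v - u \<noteq> 0" by auto
  have IH: "strip ns (full p @ (x, False) # full (y # r)) =
     P x (set p) * occupation_F ns (p @ y # r) -
     (1 - q) * x * (\<Sum>w\<in>set p. P w (set p - {w}) / (w - x) * occupation_F ns (remove1 w p @ x # y # r))"
    if "x \<in> {u, v}" for x y unfolding P_def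
    by (rule snoc.IH) (use snoc.prems that in auto)
  have "(v - u) * strip ns (full (p @ [v]) @ (u, False) # full r) =
      (v - q * u) * strip ns (full p @ (u, False) # full (v # r))
      - (1 - q) * u * strip ns (full p @ (v, False) # full (u # r))"
    using exchangeableD(2)[OF exchangeable_strip, of v u ns "full p" "full r"] vp by simp
  then have 1: "strip ns (full (p @ [v]) @ (u, False) # full r) =
      ((v - q * u) * strip ns (full p @ (u, False) # full (v # r))
      - (1 - q) * u * strip ns (full p @ (v, False) # full (u # r))) / (v - u)"
    using vu by (simp add: field_simps)
  define T where "T = (\<lambda>w. occupation_F ns (remove1 w p @ v # u # r))"
  have T: "occupation_F ns (remove1 w p @ u # v # r) = T w" for w
    unfolding T_def by (rule occupation_F_permute) simp
  \<comment> \<open>The parameter \<open>w\<close> may be lost both after the first step has kept \<open>u\<close> and after it has replaced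
    \<open>u\<close> by \<open>v\<close>; the two contributions combine into one product.\<close>
  have coeff: "(v - q * u) * (y / (w - u)) - (1 - q) * v * (y / (w - v)) =
      (v - u) * (y * ((v - q * w) / (v - w)) / (w - u))"
    if "w \<in> set p" for w y
  proof -
    have "w - u \<noteq> 0" "w - v \<noteq> 0" "v - w \<noteq> 0" using vp that by auto
    then show ?thesis by (simp add: divide_simps) (simp add: algebra_simps)
  qed
  have sums: "(v - q * u) * (\<Sum>w\<in>set p. P w (set p - {w}) / (w - u) * T w) -
        (1 - q) * v * (\<Sum>w\<in>set p. P w (set p - {w}) / (w - v) * T w) =
      (v - u) * (\<Sum>w\<in>set p. P w (insert v (set p) - {w}) / (w - u) * T w)"
    unfolding sum_distrib_left sum_subtractf[symmetric]
  proof (rule sum.cong[OF refl])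
    fix w assume w: "w \<in> set p"
    then have *: "insert v (set p) - {w} = insert v (set p - {w})" using vp by auto
    have "P w (insert v (set p) - {w}) = P w (set p - {w}) * ((v - q * w) / (v - w))"
      unfolding * P_def using vp by (subst prod.insert) auto
    then show "(v - q * u) * (P w (set p - {w}) / (w - u) * T w) -
         (1 - q) * v * (P w (set p - {w}) / (w - v) * T w) =
         (v - u) * (P w (insert v (set p) - {w}) / (w - u) * T w)"
      using arg_cong[OF coeff[OF w, of "P w (set p - {w})"], of "\<lambda>x. x * T w"]
      by (simp add: left_diff_distrib mult.assoc)
  qed
  have Pu: "P u (insert v (set p)) = (v - q * u) / (v - u) * P u (set p)"
    unfolding P_def using vp by (subst prod.insert) auto
  have set: "set (p @ [v]) = insert v (set p)" by simp
  have "(\<Sum>w\<in>set (p @ [v]). P w (set (p @ [v]) - {w}) / (w - u) * occupation_F ns (remove1 w (p @ [v]) @ u # r))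
     = P v (set p) / (v - u) * occupation_F ns (p @ u # r) + (\<Sum>w\<in>set p. P w (insert v (set p) - {w}) / (w - u) * T w)"
    unfolding set using vp by (subst sum.insert) (auto simp: remove1_append T_def intro!: sum.cong)
  moreover have "strip ns (full (p @ [v]) @ (u, False) # full r) =
     P u (insert v (set p)) * occupation_F ns (p @ v # r) - (1 - q) * u *
       (P v (set p) / (v - u) * occupation_F ns (p @ u # r) + (\<Sum>w\<in>set p. P w (insert v (set p) - {w}) / (w - u) * T w))"
  proof -
    have e: "((v - q * u) * (Pu * X - (1 - q) * u * S) - (1 - q) * u * (Pv * Y - (1 - q) * v * S')) / (v - u) =
       ((v - q * u) / (v - u) * Pu) * X - (1 - q) * u * (Pv / (v - u) * Y + Z)"
      if "(v - q * u) * S - (1 - q) * v * S' = (v - u) * Z" for Pu X S Pv Y S' Z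
    proof -
      have Z: "Z = ((v - q * u) * S - (1 - q) * v * S') / (v - u)" using that vu by simp
      show ?thesis using vu unfolding Z by (simp add: divide_simps) (simp add: algebra_simps)
    qed
    show ?thesis unfolding 1 IH[OF insertI1] IH[OF insertI2[OF singletonI]] T T_def[symmetric] Pu
      by (rule e) (use sums T T_def in simp)
  qed
  ultimately show ?case by (simp add: P_def)
qed

text \<open>Exactly one of the rows \<open>p\<close> is absorbed in the column. Induction peels off the top row \<open>v\<close> of
  \<open>p\<close>: either the absorption happened below, and \<open>v\<close> passes one arrow, or \<open>v\<close> itself is absorbed
  and becomes an empty row above \<open>p\<close>. For this the rows \<open>r\<close> above, whose outgoing bits are
  already known, must be arbitrary.\<close>
lemma column_absorb_one:
  assumes "distinct p" "\<And>v. v \<in> set p \<Longrightarrow> 1 - s * v \<noteq> 0"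
  shows "column (full p) 0 1 (\<lambda>R. strip ns (R @ full r)) =
     (\<Sum>w\<in>set p. (1 - q) / (1 - s * w) *
        (\<Prod>v\<in>set p - {w}. (v - s) / (1 - s * v) * ((v - q * w) / (v - w))) * occupation_F ns (remove1 w p @ r))"
  using assms
proof (induction p arbitrary: r rule: rev_induct)
  case (snoc v p)
  have vp: "v \<notin> set p" using snoc.prems by auto
  define P where "P x B = (\<Prod>v\<in>B. (v - q * x) / (v - x))" for x B
  define S where "S B = (\<Prod>v\<in>B. (v - s) / (1 - s * v))" for B
  have sv: "1 - s * v \<noteq> 0" using snoc.prems by auto
  define T where "T = (\<lambda>w. occupation_F ns (remove1 w p @ v # r))"
  have "column (full (p @ [v])) 0 1 (\<lambda>R. strip ns (R @ full r)) =
      (v - s * q) / (1 - s * v) * column (full p) 0 1 (\<lambda>R. strip ns (R @ full (v # r)))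
      + (1 - q) / (1 - s * v) * (column (full p) 0 0 (\<lambda>R. strip ns (R @ (v, False) # full r)))"
    using column_snoc[of "full p" v 0 1] by (simp add: row_weight_simps)
  also have "column (full p) 0 1 (\<lambda>R. strip ns (R @ full (v # r))) =
     (\<Sum>w\<in>set p. (1 - q) / (1 - s * w) *
        (\<Prod>v\<in>set p - {w}. (v - s) / (1 - s * v) * ((v - q * w) / (v - w))) * occupation_F ns (remove1 w p @ (v # r)))"
    by (rule snoc.IH) (use snoc.prems in auto)
  also have "\<dots> = (\<Sum>w\<in>set p. (1 - q) / (1 - s * w) * (S (set p - {w}) * P w (set p - {w})) * T w)"
    by (simp only: S_def P_def T_def prod.distrib)
  also have "column (full p) 0 0 (\<lambda>R. strip ns (R @ (v, False) # full r)) =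
     S (set p) * strip ns (full p @ (v, False) # full r)"
    unfolding S_def using snoc.prems
    by (subst column_full_pass) (simp add: prod.distinct_set_conv_list)
  also have "strip ns (full p @ (v, False) # full r) =
     P v (set p) * occupation_F ns (p @ r) - (1 - q) * v * (\<Sum>w\<in>set p. P w (set p - {w}) / (w - v) * T w)"
    unfolding P_def T_def by (rule empty_row_down) (use snoc.prems in auto)
  also have "(v - s * q) / (1 - s * v) * (\<Sum>w\<in>set p. (1 - q) / (1 - s * w) * (S (set p - {w}) * P w (set p - {w})) * T w)
      + (1 - q) / (1 - s * v) * (S (set p) * (P v (set p) * occupation_F ns (p @ r) - (1 - q) * v * (\<Sum>w\<in>set p. P w (set p - {w}) / (w - v) * T w)))
    = (1 - q) / (1 - s * v) * (S (set p) * P v (set p)) * occupation_F ns (p @ r) + 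
      (\<Sum>w\<in>set p. (v - s * q) / (1 - s * v) * ((1 - q) / (1 - s * w) * (S (set p - {w}) * P w (set p - {w})) * T w)
       - (1 - q) / (1 - s * v) * (S (set p) * ((1 - q) * v * (P w (set p - {w}) / (w - v) * T w))))"
    unfolding sum_subtractf sum_distrib_left[symmetric] by (simp add: algebra_simps)
  also have "(\<Sum>w\<in>set p. (v - s * q) / (1 - s * v) * ((1 - q) / (1 - s * w) * (S (set p - {w}) * P w (set p - {w})) * T w)
       - (1 - q) / (1 - s * v) * (S (set p) * ((1 - q) * v * (P w (set p - {w}) / (w - v) * T w))))
     = (\<Sum>w\<in>set p. (1 - q) / (1 - s * w) * (S (insert v (set p) - {w}) * P w (insert v (set p) - {w})) * T w)"
  proof (rule sum.cong[OF refl])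
    fix w assume w: "w \<in> set p"
    then have *: "insert v (set p) - {w} = insert v (set p - {w})" using vp by auto
    have ne: "w - v \<noteq> 0" "v - w \<noteq> 0" "1 - s * w \<noteq> 0" using vp w snoc.prems by auto
    have Pw: "P w (insert v (set p) - {w}) = ((v - q * w) / (v - w)) * P w (set p - {w})"
      unfolding * P_def using vp by (subst prod.insert) auto
    have Sw: "S (insert v (set p) - {w}) = (v - s) / (1 - s * v) * S (set p - {w})"
      unfolding * S_def using vp by (subst prod.insert) auto
    have Sp: "S (set p) = (w - s) / (1 - s * w) * S (set p - {w})"
      unfolding S_def by (rule prod.remove) (use w in auto)
    have "(v - s * q) / (1 - s * v) * ((1 - q) / (1 - s * w) * (X * Y) * t)
       - (1 - q) / (1 - s * v) * ((w - s) / (1 - s * w) * X * ((1 - q) * v * (Y / (w - v) * t)))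
       = (1 - q) / (1 - s * w) * ((v - s) / (1 - s * v) * X * ((v - q * w) / (v - w) * Y)) * t" for X Y t
    proof -
      have "(v - s * q) - (w - s) * ((1 - q) * v / (w - v)) = (v - s) * ((v - q * w) / (v - w))"
        using ne by (simp add: divide_simps) (simp add: algebra_simps)
      then have key: "(v - s * q) - (w - s) * ((1 - q) * v * inverse (w - v)) = (v - s) * ((v - q * w) / (v - w))"
        by (simp add: divide_inverse mult_ac)
      define a b e f where abe: "a = inverse (1 - s * v)" "b = inverse (1 - s * w)" "e = inverse (w - v)"
        "f = (v - q * w) / (v - w)"
      have "(v - s * q) * a * ((1 - q) * b * (X * Y) * t) - (1 - q) * a * ((w - s) * b * X * ((1 - q) * v * (Y * e * t)))
         = (X * Y * t * (1 - q) * a * b) * ((v - s * q) - (w - s) * ((1 - q) * v * e))"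
        by (simp add: algebra_simps)
      also have "\<dots> = (1 - q) * b * ((v - s) * a * X * (f * Y)) * t"
        unfolding abe key by (simp only: mult_ac)
      finally show ?thesis unfolding abe by (simp only: divide_inverse)
    qed
    then show "(v - s * q) / (1 - s * v) * ((1 - q) / (1 - s * w) * (S (set p - {w}) * P w (set p - {w})) * T w)
       - (1 - q) / (1 - s * v) * (S (set p) * ((1 - q) * v * (P w (set p - {w}) / (w - v) * T w)))
     = (1 - q) / (1 - s * w) * (S (insert v (set p) - {w}) * P w (insert v (set p) - {w})) * T w"
      unfolding Pw Sw Sp .
  qed
  also have "(1 - q) / (1 - s * v) * (S (set p) * P v (set p)) * occupation_F ns (p @ r) +
      (\<Sum>w\<in>set p. (1 - q) / (1 - s * w) * (S (insert v (set p) - {w}) * P w (insert v (set p) - {w})) * T w)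
     = (\<Sum>w\<in>set (p @ [v]). (1 - q) / (1 - s * w) * (S (set (p @ [v]) - {w}) * P w (set (p @ [v]) - {w})) * occupation_F ns (remove1 w (p @ [v]) @ r))"
  proof -
    have set: "set (p @ [v]) = insert v (set p)" by simp
    show ?thesis unfolding set using vp 
      by (subst sum.insert) (auto simp: remove1_append T_def intro!: sum.cong)
  qed
  finally show ?case by (simp only: S_def P_def prod.distrib)
qed simp

lemma occupation_F_split_one:
  assumes "distinct p" "\<And>v. v \<in> set p \<Longrightarrow> 1 - s * v \<noteq> 0"
  shows "occupation_F (1 # ns) p = (\<Sum>w\<in>set p. (1 - q) / (1 - s * w) *
        (\<Prod>v\<in>set p - {w}. (v - s) / (1 - s * v) * ((v - q * w) / (v - w))) * occupation_F ns (remove1 w p))"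
  using column_absorb_one[of p ns "[]"] assms by (simp add: occupation_F_def)

text \<open>At \<open>u = s\<close> the path of the bottom row cannot go straight through column \<open>0\<close>, and if it turned up
  it would have to leave the column at the top.\<close>
lemma occupation_F_s_zero: "occupation_F (0 # ns) (s # vs) = 0"
  by (simp add: occupation_F_def UNIV_bool row_weight_simps column_full_zero)

text \<open>The path of the bottom row turns up in column \<open>0\<close>; all others pass one arrow, and the bottom row is
  empty from then on.\<close>
lemma occupation_F_s_one:
  assumes "1 - s * s \<noteq> 0"
  shows "occupation_F (1 # ns) (s # vs) = (1 - q) / (1 - s * s) * (\<Prod>v\<leftarrow>vs. (v - s * q) / (1 - s * v)) * occupation_F ns vs"
  using column_full_pass[of vs 1 "\<lambda>R. strip ns ((s, False) # R)"] assms
  by (simp add: occupation_F_def UNIV_bool row_weight_simps strip_empty_row)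

lemma occupation_F_s_ones:
  assumes "1 - s * s \<noteq> 0"
  shows "occupation_F (replicate k 1 @ ns) (replicate k s @ vs) =
    (\<Prod>i<k. (1 - q) / (1 - s * s) * ((s - s * q) / (1 - s * s)) ^ i) *
    (\<Prod>v\<leftarrow>vs. (v - s * q) / (1 - s * v)) ^ k * occupation_F ns vs"
proof (induction k)
  case (Suc k)
  show ?case using occupation_F_s_one[OF assms, of "replicate k 1 @ ns" "replicate k s @ vs"]
    by (simp add: Suc.IH del: One_nat_def)
qed simp

lemma occupation_F_s_vanish:
  assumes "1 - s * s \<noteq> 0" "j < k"
  shows "occupation_F (replicate j 1 @ 0 # ns) (replicate k s @ vs) = 0"
proof -
  have "replicate k s @ vs = replicate j s @ s # (replicate (k - Suc j) s @ vs)"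
    using assms(2) by (metis add_diff_inverse_nat append_Cons append_assoc less_imp_not_less not_less_eq
      replicate_Suc replicate_add replicate_app_Cons_same add_Suc_shift)
  then show ?thesis using occupation_F_s_ones[OF assms(1), of j "0 # ns"] occupation_F_s_zero by simp
qed

text \<open>The function \<open>F_\<lambda>(u_I)\<close>, with the index set as the argument; by symmetry any listing of
  \<open>I\<close> gives the same value.\<close>
definition set_F :: "nat list \<Rightarrow> (nat \<Rightarrow> complex) \<Rightarrow> nat set \<Rightarrow> complex" where
  "set_F ns u A = occupation_F ns (map u (sorted_list_of_set A))"

lemma set_F_eq:
  assumes "finite A" "mset us = image_mset u (mset_set A)"
  shows "occupation_F ns us = set_F ns u A"
  unfolding set_F_def by (rule occupation_F_permute) (use assms in \<open>simp flip: sorted_list_of_mset_set\<close>)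

lemma set_F_split_one:
  assumes fin: "finite A" and inj: "inj_on u A" and ne: "\<And>i. i \<in> A \<Longrightarrow> 1 - s * u i \<noteq> 0"
  shows "set_F (1 # ns) u A = (\<Sum>i\<in>A. (1 - q) / (1 - s * u i) *
      (\<Prod>j\<in>A - {i}. (u j - s) / (1 - s * u j) * ((u j - q * u i) / (u j - u i))) * set_F ns u (A - {i}))"
proof -
  define p where "p = map u (sorted_list_of_set A)"
  have set: "set p = u ` A" and dist: "distinct p"
    using fin inj by (auto simp: p_def distinct_map)
  have "set_F (1 # ns) u A = (\<Sum>w\<in>u ` A. (1 - q) / (1 - s * w) *
      (\<Prod>v\<in>u ` A - {w}. (v - s) / (1 - s * v) * ((v - q * w) / (v - w))) * occupation_F ns (remove1 w p))"
    unfolding set_F_def p_def[symmetric] set[symmetric]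
    by (rule occupation_F_split_one[OF dist]) (use set ne in auto)
  also have "\<dots> = (\<Sum>i\<in>A. (1 - q) / (1 - s * u i) *
      (\<Prod>v\<in>u ` A - {u i}. (v - s) / (1 - s * v) * ((v - q * u i) / (v - u i))) * occupation_F ns (remove1 (u i) p))"
    by (subst sum.reindex[OF inj]) simp
  also have "\<dots> = (\<Sum>i\<in>A. (1 - q) / (1 - s * u i) *
      (\<Prod>j\<in>A - {i}. (u j - s) / (1 - s * u j) * ((u j - q * u i) / (u j - u i))) * set_F ns u (A - {i}))"
  proof (rule sum.cong[OF refl])
    fix i assume i: "i \<in> A"
    have im: "u ` A - {u i} = u ` (A - {i})" using inj i by (auto simp: inj_on_def)
    have inj': "inj_on u (A - {i})" using inj by (auto simp: inj_on_def)
    have "occupation_F ns (remove1 (u i) p) = set_F ns u (A - {i})"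
    proof (rule set_F_eq)
      show "mset (remove1 (u i) p) = image_mset u (mset_set (A - {i}))"
        using mset_set.remove[OF fin i] by (simp add: p_def flip: sorted_list_of_mset_set)
    qed (use fin in simp)
    then show "(1 - q) / (1 - s * u i) *
      (\<Prod>v\<in>u ` A - {u i}. (v - s) / (1 - s * v) * ((v - q * u i) / (v - u i))) * occupation_F ns (remove1 (u i) p) =
      (1 - q) / (1 - s * u i) *
      (\<Prod>j\<in>A - {i}. (u j - s) / (1 - s * u j) * ((u j - q * u i) / (u j - u i))) * set_F ns u (A - {i})"
      unfolding im by (simp add: prod.reindex[OF inj'])
  qed
  finally show ?thesis .
qed

text \<open>Iterating the splitting of one column chooses the set \<open>I\<close> element by element. Collecting the terms
  with the same \<open>I\<close>, the inner sum over its first chosen element \<open>i\<close> is the splitting of one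
  column of \<open>F_k(u_I)\<close>, and the remaining factors depend only on \<open>I\<close>.\<close>
lemma set_F_split:
  assumes "finite A" "inj_on u A" "\<And>i. i \<in> A \<Longrightarrow> 1 - s * u i \<noteq> 0"
  shows "set_F (replicate k 1 @ ns) u A = (\<Sum>I | I \<subseteq> A \<and> card I = k.
      (\<Prod>i\<in>I. \<Prod>j\<in>A - I. (u j - q * u i) / (u j - u i)) *
      (\<Prod>j\<in>A - I. ((u j - s) / (1 - s * u j)) ^ k) *
      set_F (replicate k 1) u I * set_F ns u (A - I))"
  using assms
proof (induction k arbitrary: A)
  case 0
  have "{I. I \<subseteq> A \<and> card I = 0} = {{}}"
    using 0(1) by (auto dest: finite_subset)
  then show ?case by (simp add: set_F_def occupation_F_def)
next
  case (Suc k)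
  define x where "x j i = (u j - q * u i) / (u j - u i)" for j i
  define r where "r j = (u j - s) / (1 - s * u j)" for j
  define d where "d i = (1 - q) / (1 - s * u i)" for i
  let ?S = "\<lambda>A k. {I. I \<subseteq> A \<and> card I = k}"
  have fin: "finite B" if "B \<subseteq> A" for B using that Suc.prems(1) finite_subset by blast
  have one: "set_F (1 # ms) u B = (\<Sum>i\<in>B. d i * (\<Prod>j\<in>B - {i}. r j * x j i) * set_F ms u (B - {i}))" 
    if "B \<subseteq> A" for ms B
    unfolding d_def r_def x_def using Suc.prems that fin
    by (intro set_F_split_one) (auto intro: inj_on_subset)
  define g where "g i I' = d i * (\<Prod>j\<in>A - {i}. r j * x j i) *
      ((\<Prod>i'\<in>I'. \<Prod>j\<in>A - {i} - I'. x j i') * (\<Prod>j\<in>A - {i} - I'. r j ^ k) *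
       set_F (replicate k 1) u I' * set_F ns u (A - {i} - I'))" for i I'
  have "set_F (replicate (Suc k) 1 @ ns) u A = set_F (1 # (replicate k 1 @ ns)) u A" by simp
  also have "\<dots> = (\<Sum>i\<in>A. \<Sum>I'\<in>?S (A - {i}) k. g i I')"
  proof (subst one[OF subset_refl], rule sum.cong[OF refl])
    fix i assume i: "i \<in> A"
    have "set_F (replicate k 1 @ ns) u (A - {i}) = (\<Sum>I'\<in>?S (A - {i}) k.
      (\<Prod>i'\<in>I'. \<Prod>j\<in>A - {i} - I'. x j i') * (\<Prod>j\<in>A - {i} - I'. r j ^ k) *
       set_F (replicate k 1) u I' * set_F ns u (A - {i} - I'))"
      unfolding x_def r_def using Suc.prems by (intro Suc.IH) (auto intro: inj_on_subset)
    then show "d i * (\<Prod>j\<in>A - {i}. r j * x j i) * set_F (replicate k 1 @ ns) u (A - {i}) =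
        (\<Sum>I'\<in>?S (A - {i}) k. g i I')"
      by (simp add: g_def sum_distrib_left)
  qed
  also have "\<dots> = (\<Sum>(i, I')\<in>Sigma A (\<lambda>i. ?S (A - {i}) k). g i I')"
    using Suc.prems(1) by (intro sum.Sigma) auto
  also have "\<dots> = (\<Sum>(I, i)\<in>Sigma (?S A (Suc k)) (\<lambda>I. I). g i (I - {i}))"
    by (rule sum.reindex_bij_witness[of _ "\<lambda>(I, i). (i, I - {i})" "\<lambda>(i, I'). (insert i I', i)"])
       (auto simp: card_insert_if fin finite_subset[OF _ finite_Diff[OF Suc.prems(1)]] intro!: arg_cong2[of _ _ _ _ g])
  also have "\<dots> = (\<Sum>I\<in>?S A (Suc k). \<Sum>i\<in>I. g i (I - {i}))"
    using Suc.prems(1) fin by (intro sum.Sigma[symmetric]) auto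
  also have "\<dots> = (\<Sum>I\<in>?S A (Suc k). (\<Prod>i\<in>I. \<Prod>j\<in>A - I. x j i) * (\<Prod>j\<in>A - I. r j ^ Suc k) *
      set_F (replicate (Suc k) 1) u I * set_F ns u (A - I))"
  proof (rule sum.cong[OF refl])
    fix I assume I: "I \<in> ?S A (Suc k)"
    have "g i (I - {i}) = (\<Prod>i\<in>I. \<Prod>j\<in>A - I. x j i) * (\<Prod>j\<in>A - I. r j ^ Suc k) *
        (d i * (\<Prod>j\<in>I - {i}. r j * x j i) * set_F (replicate k 1) u (I - {i})) * set_F ns u (A - I)" 
      if i: "i \<in> I" for i
    proof -
      have 1: "A - {i} - (I - {i}) = A - I" using i I by auto
      have 2: "A - {i} = (I - {i}) \<union> (A - I)" using i I by auto
      have 3: "(\<Prod>j\<in>A - {i}. r j * x j i) =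
         (\<Prod>j\<in>I - {i}. r j * x j i) * ((\<Prod>j\<in>A - I. r j) * (\<Prod>j\<in>A - I. x j i))"
        unfolding 2 by (subst prod.union_disjoint) (use fin I Suc.prems(1) in \<open>auto simp: prod.distrib\<close>)
      have 4: "(\<Prod>i\<in>I. \<Prod>j\<in>A - I. x j i) = (\<Prod>j\<in>A - I. x j i) * (\<Prod>i\<in>I - {i}. \<Prod>j\<in>A - I. x j i)"
        by (rule prod.remove) (use fin I i in auto)
      show ?thesis unfolding g_def 1 3 4 by (simp add: prod.distrib mult_ac)
    qed
    moreover have "set_F (replicate (Suc k) 1) u I =
        (\<Sum>i\<in>I. d i * (\<Prod>j\<in>I - {i}. r j * x j i) * set_F (replicate k 1) u (I - {i}))"
      using I one[of I "replicate k 1"] by simp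
    ultimately show "(\<Sum>i\<in>I. g i (I - {i})) = (\<Prod>i\<in>I. \<Prod>j\<in>A - I. x j i) * (\<Prod>j\<in>A - I. r j ^ Suc k) *
      set_F (replicate (Suc k) 1) u I * set_F ns u (A - I)"
      by (simp add: sum_distrib_left sum_distrib_right)
  qed
  finally show ?case by (simp add: x_def r_def)
qed

end

section \<open>Path collections as conserved flows\<close>

definition inflow :: "arrows \<Rightarrow> int \<Rightarrow> int \<Rightarrow> nat" where
  "inflow \<omega> i j = \<omega> ((i - 1, j), (i, j)) + \<omega> ((i, j - 1), (i, j))"

definition outflow :: "arrows \<Rightarrow> int \<Rightarrow> int \<Rightarrow> nat" where
  "outflow \<omega> i j = \<omega> ((i, j), (i + 1, j)) + \<omega> ((i, j), (i, j + 1))"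

text \<open>Conserved arrow counts in the strip, with one unit entering row \<open>j\<close> for every \<open>j \<in> Y\<close>. The first
  condition leaves no other edge on which arrows could enter; in particular the vertical edges
  \<open>(i,0) \<rightarrow> (i,1)\<close> are empty, and an edge starting in column \<open>-1\<close> must lead to column \<open>0\<close>.\<close>
definition flow :: "nat \<Rightarrow> nat set \<Rightarrow> arrows \<Rightarrow> bool" where
  "flow m Y \<omega> \<longleftrightarrow>
     (\<forall>a b. \<omega> (a, b) \<noteq> 0 \<longrightarrow> up_right_step a b \<and> 1 \<le> snd a \<and> snd a \<le> int m \<and> 0 \<le> fst b) \<and>
     (\<forall>j\<in>{1..m}. \<omega> ((-1, int j), (0, int j)) = of_bool (j \<in> Y)) \<and>
     (\<forall>i j. 0 \<le> i \<longrightarrow> 1 \<le> j \<longrightarrow> j \<le> int m \<longrightarrow> inflow \<omega> i j = outflow \<omega> i j) \<and>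
     (\<exists>N. \<forall>a b. N \<le> fst a \<longrightarrow> \<omega> (a, b) = 0)"

lemma flowD:
  assumes "flow m Y \<omega>"
  shows "\<omega> (a, b) \<noteq> 0 \<Longrightarrow> up_right_step a b"
    and "\<omega> (a, b) \<noteq> 0 \<Longrightarrow> 1 \<le> snd a" and "\<omega> (a, b) \<noteq> 0 \<Longrightarrow> snd a \<le> int m"
    and "\<omega> (a, b) \<noteq> 0 \<Longrightarrow> 0 \<le> fst b"
    and "j \<in> {1..m} \<Longrightarrow> \<omega> ((-1, int j), (0, int j)) = of_bool (j \<in> Y)"
    and "0 \<le> i \<Longrightarrow> 1 \<le> k \<Longrightarrow> k \<le> int m \<Longrightarrow> inflow \<omega> i k = outflow \<omega> i k"
  using assms unfolding flow_def by blast+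

lemma flow_zero: "flow m {} (\<lambda>e. 0)"
  by (auto simp: flow_def inflow_def outflow_def)

lemma flow_add:
  assumes "flow m X \<omega>" "flow m Y \<omega>'" "X \<inter> Y = {}"
  shows "flow m (X \<union> Y) (\<lambda>e. \<omega> e + \<omega>' e)"
proof -
  from assms obtain M N where "\<forall>a b. M \<le> fst a \<longrightarrow> \<omega> (a, b) = 0" "\<forall>a b. N \<le> fst a \<longrightarrow> \<omega>' (a, b) = 0"
    unfolding flow_def by blast
  then have "\<exists>K. \<forall>a b. K \<le> fst a \<longrightarrow> \<omega> (a, b) + \<omega>' (a, b) = 0"
    by (intro exI[of _ "max M N"]) auto
  moreover have "of_bool (j \<in> X) + of_bool (j \<in> Y) = (of_bool (j \<in> X \<or> j \<in> Y) :: nat)" for j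
    using assms(3) by auto
  moreover have "inflow (\<lambda>e. \<omega> e + \<omega>' e) i j = inflow \<omega> i j + inflow \<omega>' i j"
     "outflow (\<lambda>e. \<omega> e + \<omega>' e) i j = outflow \<omega> i j + outflow \<omega>' i j" for i j
    by (simp_all add: inflow_def outflow_def)
  ultimately show ?thesis
    using assms(1,2) unfolding flow_def by simp
qed

lemma flow_remove:
  assumes "flow m Y (\<lambda>e. \<omega> e + \<omega>' e)" "flow m {y} \<omega>'"
  shows "flow m (Y - {y}) \<omega>"
proof -
  have "inflow \<omega> i j = outflow \<omega> i j" if "0 \<le> i" "1 \<le> j" "j \<le> int m" for i j
    using flowD(6)[OF assms(1), of i j] flowD(6)[OF assms(2), of i j] that
    by (simp add: inflow_def outflow_def)
  moreover have "\<omega> ((-1, int j), (0, int j)) = of_bool (j \<in> Y - {y})" if "j \<in> {1..m}" for j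
    using flowD(5)[OF assms(1), of j] flowD(5)[OF assms(2), of j] that
    by (auto split: if_splits simp: of_bool_def)
  moreover have "\<exists>N. \<forall>a b. N \<le> fst a \<longrightarrow> \<omega> (a, b) = 0"
  proof -
    from assms(1) obtain N where "\<forall>a b. N \<le> fst a \<longrightarrow> \<omega> (a, b) + \<omega>' (a, b) = 0"
      unfolding flow_def by blast
    then show ?thesis by (intro exI[of _ N]) simp
  qed
  moreover have "up_right_step a b \<and> 1 \<le> snd a \<and> snd a \<le> int m \<and> 0 \<le> fst b" if "\<omega> (a, b) \<noteq> 0" for a b
    using flowD(1-4)[OF assms(1), of a b] that by simp
  ultimately show ?thesis
    unfolding flow_def by blast
qed

text \<open>Arrows only move up and right, so by induction along the diagonals \<open>i + j\<close> nothing flows if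
  nothing enters.\<close>
lemma flow_unique_zero:
  assumes "flow m {} \<omega>" shows "\<omega> e = 0"
proof (rule ccontr)
  have in0: "inflow \<omega> i j = 0" if "0 \<le> i" "1 \<le> j" "j \<le> int m" for i j
    using that
  proof (induction "nat (i + j)" arbitrary: i j rule: less_induct)
    case less
    have "\<omega> ((i - 1, j), (i, j)) = 0"
    proof (cases "i = 0")
      case True
      then show ?thesis using flowD(5)[OF assms, of "nat j"] less.prems by (auto simp: le_nat_iff nat_le_iff)
    next
      case False
      then have "outflow \<omega> (i - 1) j = 0"
        using less.hyps[of "i - 1" j] flowD(6)[OF assms, of "i - 1" j] less.prems by auto
      then show ?thesis by (simp add: outflow_def)
    qed
    moreover have "\<omega> ((i, j - 1), (i, j)) = 0"
    proof (cases "j = 1")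
      case True
      then show ?thesis using flowD(2)[OF assms, of "(i, j - 1)" "(i, j)"] by auto
    next
      case False
      then have "outflow \<omega> i (j - 1) = 0"
        using less.hyps[of i "j - 1"] flowD(6)[OF assms, of i "j - 1"] less.prems by auto
      then show ?thesis by (simp add: outflow_def)
    qed
    ultimately show ?case by (simp add: inflow_def)
  qed
  assume "\<omega> e \<noteq> 0"
  obtain i j b where e: "e = ((i, j), b)" by (metis prod.exhaust)
  note D = flowD(1-4)[OF assms \<open>\<omega> e \<noteq> 0\<close>[unfolded e]]
  show False
  proof (cases "0 \<le> i")
    case True
    then have "outflow \<omega> i j = 0" using in0[of i j] flowD(6)[OF assms, of i j] D by auto
    then show False using D(1) \<open>\<omega> e \<noteq> 0\<close> by (auto simp: e outflow_def up_right_step_def)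
  next
    case False
    then have "i = -1" "b = (0, j)" using D by (auto simp: up_right_step_def)
    then show False using \<open>\<omega> e \<noteq> 0\<close> flowD(5)[OF assms, of "nat j"] D by (auto simp: e le_nat_iff nat_le_iff)
  qed
qed

lemma in_path_edges: "(a, b) \<in> path_edges p \<longleftrightarrow> (\<exists>i. Suc i < length p \<and> a = p ! i \<and> b = p ! Suc i)"
  unfolding path_edges_def by (auto simp: in_set_zip nth_tl less_diff_conv)

lemma path_edges_Cons: "r \<noteq> [] \<Longrightarrow> path_edges (x # r) = insert (x, hd r) (path_edges r)"
  by (cases r) (auto simp: path_edges_def)

context
  fixes m y :: nat and l :: int and p :: "point list"
  assumes lp: "lattice_path m y l p" and y: "y \<in> {1..m}"
begin

lemma lattice_path_le:
  assumes "(a, b) \<in> path_edges p" shows "fst a \<le> fst b \<and> fst b \<le> l"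
proof -
  from lp obtain r where r: "p = r @ [(l, int m + 1)]" and "successively up_right_step p"
    unfolding lattice_path_def by (metis append_Cons)
  then have "successively (\<lambda>a b. fst a \<le> fst b) p"
    by (auto elim: successively_mono simp: up_right_step_def)
  then have sorted: "sorted_wrt (\<lambda>a b. fst a \<le> fst b) p"
    by (subst (asm) successively_conv_sorted_wrt) (auto simp: transp_def)
  from assms obtain i where i: "Suc i < length p" "a = p ! i" "b = p ! Suc i"
    by (auto simp: in_path_edges)
  then have "fst a \<le> fst b" using sorted by (simp add: sorted_wrt_iff_nth_less)
  moreover have "b \<in> set p" using i by simp
  then have "fst b \<le> l" using sorted unfolding r by (auto simp: sorted_wrt_append)
  ultimately show ?thesis ..
qed

text \<open>Along a path the sum of the coordinates grows by one in each step. Hence no vertex is visited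
  twice, and an inner vertex of the path has one incoming and one outgoing edge on it.\<close>
lemma lattice_path_flow: "flow m {y} (\<lambda>e. of_bool (e \<in> path_edges p))"
  and lattice_path_top: "((i, int m), (i, int m + 1)) \<in> path_edges p \<longleftrightarrow> i = l"
proof -
  from lp obtain r where r: "p = (-1, int y) # r @ [(l, int m + 1)]" "r \<noteq> []" "hd r = (0, int y)"
    "last r = (l, int m)" "set r \<subseteq> {0..} \<times> {1..int m}" "successively up_right_step p"
    unfolding lattice_path_def by blast
  define n where "n = Suc (length r)"
  have n: "length p = Suc n" "1 < n" and p0: "p ! 0 = (-1, int y)" and pn: "p ! n = (l, int m + 1)"
    using r by (auto simp: n_def nth_append)
  have p1: "p ! 1 = (0, int y)" using r by (simp add: nth_append hd_conv_nth)
  have pn': "p ! (n - 1) = (l, int m)"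
    using r by (cases r rule: rev_cases) (auto simp: nth_append n_def)
  have reg: "0 \<le> fst (p ! i) \<and> 1 \<le> snd (p ! i) \<and> snd (p ! i) \<le> int m" if "0 < i" "i < n" for i
  proof -
    from \<open>0 < i\<close> obtain k where k: "i = Suc k" by (auto simp: gr0_conv_Suc)
    then have "k < length r" using that(2) by (simp add: n_def)
    then have "p ! i = r ! k" by (simp add: r(1) k nth_append)
    then have "p ! i \<in> {0..} \<times> {1..int m}" using r(5) nth_mem[OF \<open>k < length r\<close>] by (metis subsetD)
    then show ?thesis by auto
  qed
  have step: "up_right_step (p ! i) (p ! Suc i)" if "i < n" for i
    using r(6) n that by (simp add: successively_conv_nth)
  have E: "(a, b) \<in> path_edges p \<longleftrightarrow> (\<exists>i<n. a = p ! i \<and> b = p ! Suc i)" for a b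
    by (auto simp: in_path_edges n)
  have height: "fst (p ! i) + snd (p ! i) = int y - 1 + int i" if "i \<le> n" for i
    using that
  proof (induction i)
    case (Suc i)
    then show ?case using step[of i] by (auto simp: up_right_step_def)
  qed (simp add: p0)
  have inj: "i = j" if "p ! i = p ! j" "i \<le> n" "j \<le> n" for i j
  proof -
    have "int y - 1 + int i = int y - 1 + int j"
      using height[OF that(2)] height[OF that(3)] unfolding that(1) by (rule trans[OF sym])
    then show ?thesis by simp
  qed
  have l0: "0 \<le> l" using reg[of "n - 1"] pn' n by auto
  have supp: "up_right_step a b \<and> 1 \<le> snd a \<and> snd a \<le> int m \<and> 0 \<le> fst b" if "(a, b) \<in> path_edges p" for a b
  proof -
    from that obtain i where i: "i < n" "a = p ! i" "b = p ! Suc i" by (auto simp: E)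
    have "1 \<le> snd a \<and> snd a \<le> int m"
      using reg[of i] i y p0 by (cases "i = 0") auto
    moreover have "0 \<le> fst b"
      using reg[of "Suc i"] i pn l0 by (cases "Suc i = n") auto
    ultimately show ?thesis using step i by auto
  qed
  have src: "((-1, int j), (0, int j)) \<in> path_edges p \<longleftrightarrow> j = y" for j
  proof
    assume "((-1, int j), (0, int j)) \<in> path_edges p"
    then obtain i where i: "i < n" "p ! i = (-1, int j)" by (auto simp: E)
    then have "i = 0" using reg[of i] by (cases "i = 0") auto
    then show "j = y" using i p0 by simp
  next
    assume "j = y"
    then show "((-1, int j), (0, int j)) \<in> path_edges p" using p0 p1 n by (auto simp: E intro!: exI[of _ 0])
  qed
  have cons: "inflow (\<lambda>e. of_bool (e \<in> path_edges p)) i j = outflow (\<lambda>e. of_bool (e \<in> path_edges p)) i j"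
    if ij: "0 \<le> i" "1 \<le> j" "j \<le> int m" for i j
  proof (cases "(i, j) \<in> set p")
    case False
    have "(a, (i, j)) \<notin> path_edges p" "((i, j), a) \<notin> path_edges p" for a
      using False by (auto simp: in_path_edges)
    then show ?thesis by (simp add: inflow_def outflow_def)
  next
    case True
    then obtain k where k: "k \<le> n" "p ! k = (i, j)" using n by (auto simp: in_set_conv_nth less_Suc_eq_le)
    have kn: "0 < k" "k < n" using k ij p0 pn by (auto intro!: gr0I simp: le_less)
    have "(a, (i, j)) \<in> path_edges p \<longleftrightarrow> a = p ! (k - 1)" for a
    proof
      assume "(a, (i, j)) \<in> path_edges p"
      then obtain h where "h < n" "a = p ! h" "p ! Suc h = (i, j)" by (auto simp: E)
      then have "Suc h = k" using inj[of "Suc h" k] k by simp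
      then show "a = p ! (k - 1)" using \<open>a = p ! h\<close> by auto
    next
      assume "a = p ! (k - 1)"
      then show "(a, (i, j)) \<in> path_edges p" using kn k by (auto simp: E intro!: exI[of _ "k - 1"])
    qed
    moreover have "((i, j), a) \<in> path_edges p \<longleftrightarrow> a = p ! Suc k" for a
    proof
      assume "((i, j), a) \<in> path_edges p"
      then obtain h where h: "h < n" "p ! h = (i, j)" "a = p ! Suc h" by (auto simp: E)
      then have "h = k" using inj[of h k] k kn by simp
      then show "a = p ! Suc k" using h by simp
    next
      assume "a = p ! Suc k"
      then show "((i, j), a) \<in> path_edges p" using kn k unfolding E by (intro exI[of _ k]) simp
    qed
    moreover have "p ! (k - 1) = (i - 1, j) \<or> p ! (k - 1) = (i, j - 1)"
      using step[of "k - 1"] kn k(2) by (cases "p ! (k - 1)") (simp add: up_right_step_def, linarith)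
    moreover have "p ! Suc k = (i + 1, j) \<or> p ! Suc k = (i, j + 1)"
      using step[OF kn(2)] k(2) by (simp add: up_right_step_def)
    ultimately show ?thesis
      unfolding inflow_def outflow_def by (elim disjE) simp_all
  qed
  have bd: "\<exists>N. \<forall>a b. N \<le> fst a \<longrightarrow> (a, b) \<notin> path_edges p"
    using lattice_path_le by (intro exI[of _ "l + 1"]) force
  show "flow m {y} (\<lambda>e. of_bool (e \<in> path_edges p))"
    unfolding flow_def using supp src cons bd by auto
  show "((i, int m), (i, int m + 1)) \<in> path_edges p \<longleftrightarrow> i = l"
  proof
    assume "((i, int m), (i, int m + 1)) \<in> path_edges p"
    then obtain h where h: "h < n" "p ! Suc h = (i, int m + 1)" by (auto simp: E)
    then have "Suc h = n" using reg[of "Suc h"] by (cases "Suc h = n") auto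
    then show "i = l" using h pn by simp
  next
    assume "i = l"
    then show "((i, int m), (i, int m + 1)) \<in> path_edges p"
      using pn pn' n by (auto simp: E intro!: exI[of _ "n - 1"])
  qed
qed

end

text \<open>Conservation lets one continue along arrows from any vertex that is reached; as the columns
  carrying arrows are bounded, the walk ends at the top boundary.\<close>
lemma flow_follow:
  assumes fl: "flow m Y \<omega>" and "0 \<le> i" "1 \<le> j" "j \<le> int m" "inflow \<omega> i j > 0"
  shows "\<exists>r l. r \<noteq> [] \<and> hd r = (i, j) \<and> last r = (l, int m) \<and> set r \<subseteq> {0..} \<times> {1..int m} \<and>
     successively up_right_step (r @ [(l, int m + 1)]) \<and>
     (\<forall>e\<in>path_edges (r @ [(l, int m + 1)]). \<omega> e > 0)"
proof -
  obtain N where N: "\<And>a b. N \<le> fst a \<Longrightarrow> \<omega> (a, b) = 0" using fl unfolding flow_def by blast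
  show ?thesis using assms(2-)
  proof (induction "nat (N + int m - i - j)" arbitrary: i j rule: less_induct)
    case less
    have out: "outflow \<omega> i j > 0" using flowD(6)[OF fl less.prems(1-3)] less.prems(4) by simp
    have iN: "i < N" using out N[of "(i, j)"] by (auto simp: outflow_def intro: ccontr)
    have extend: ?case if step: "v = (i + 1, j) \<or> v = (i, j + 1)" and v: "snd v \<le> int m" and pos: "\<omega> ((i, j), v) > 0" for v
    proof -
      obtain i' j' where v': "v = (i', j')" by (cases v)
      have "inflow \<omega> i' j' > 0" using pos step by (auto simp: v' inflow_def)
      then obtain r l where r: "r \<noteq> []" "hd r = (i', j')" "last r = (l, int m)" "set r \<subseteq> {0..} \<times> {1..int m}"
        "successively up_right_step (r @ [(l, int m + 1)])" "\<forall>e\<in>path_edges (r @ [(l, int m + 1)]). \<omega> e > 0"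
        using less.hyps[of i' j'] step v v' less.prems iN by auto
      have "successively up_right_step (((i, j) # r) @ [(l, int m + 1)])"
        using r step by (auto simp: successively_Cons hd_append v' up_right_step_def)
      moreover have "\<forall>e\<in>path_edges (((i, j) # r) @ [(l, int m + 1)]). \<omega> e > 0"
        using r pos by (auto simp: path_edges_Cons hd_append v')
      ultimately show ?thesis using r less.prems by (intro exI[of _ "(i, j) # r"] exI[of _ l]) auto
    qed
    consider "\<omega> ((i, j), (i, j + 1)) > 0" | "\<omega> ((i, j), (i + 1, j)) > 0" using out by (auto simp: outflow_def)
    then show ?case
    proof cases
      case 1
      show ?thesis
      proof (cases "j = int m")
        case True
        then show ?thesis using 1 less.prems
          by (intro exI[of _ "[(i, j)]"] exI[of _ i]) (auto simp: path_edges_def up_right_step_def)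
      next
        case False
        then show ?thesis using extend[of "(i, j + 1)"] 1 less.prems by auto
      qed
    next
      case 2
      then show ?thesis using extend[of "(i + 1, j)"] less.prems by auto
    qed
  qed
qed

lemma flow_path:
  assumes fl: "flow m Y \<omega>" and y: "y \<in> Y" "y \<in> {1..m}"
  obtains p l where "lattice_path m y l p" "\<And>e. e \<in> path_edges p \<Longrightarrow> \<omega> e > 0"
proof -
  have 1: "\<omega> ((-1, int y), (0, int y)) = 1" using flowD(5)[OF fl y(2)] y(1) by simp
  have "inflow \<omega> 0 (int y) > 0" using 1 by (simp add: inflow_def)
  then obtain r l where r: "r \<noteq> []" "hd r = (0, int y)" "last r = (l, int m)" "set r \<subseteq> {0..} \<times> {1..int m}"
        "successively up_right_step (r @ [(l, int m + 1)])" "\<forall>e\<in>path_edges (r @ [(l, int m + 1)]). \<omega> e > 0"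
    using flow_follow[OF fl, of 0 "int y"] y by auto
  show ?thesis
  proof (rule that)
    show "lattice_path m y l ((-1, int y) # r @ [(l, int m + 1)])"
      unfolding lattice_path_def using r 
      by (intro exI[of _ r]) (auto simp: successively_Cons hd_append up_right_step_def)
    fix e assume "e \<in> path_edges ((-1, int y) # r @ [(l, int m + 1)])"
    then show "\<omega> e > 0" using r 1 by (auto simp: path_edges_Cons hd_append)
  qed
qed

lemma card_filter_insert:
  "finite Y \<Longrightarrow> y \<notin> Y \<Longrightarrow> card {z \<in> insert y Y. Q z} = card {z \<in> Y. Q z} + of_bool (Q y)"
  by (cases "Q y") (auto simp: Collect_conv_if insert_Collect[symmetric] conj_disj_distribR Collect_disj_eq)

text \<open>Follow the arrows from one source, remove the path that was found, and continue with the remaining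
  flow, which has one source less. When no source is left the flow is zero.\<close>
lemma flow_decompose:
  assumes "finite Y" "Y \<subseteq> {1..m}" "flow m Y \<omega>"
  shows "\<exists>P l. (\<forall>y\<in>Y. lattice_path m y (l y) (P y)) \<and> \<omega> = (\<lambda>e. card {y \<in> Y. e \<in> path_edges (P y)})"
  using assms
proof (induction Y arbitrary: \<omega> rule: finite_induct)
  case empty
  then show ?case using flow_unique_zero by auto
next
  case (insert y Y)
  obtain p l where p: "lattice_path m y l p" "\<And>e. e \<in> path_edges p \<Longrightarrow> \<omega> e > 0"
    by (rule flow_path[OF insert.prems(2), of y]) (use insert.prems(1) in auto)
  define \<omega>' where "\<omega>' e = \<omega> e - of_bool (e \<in> path_edges p)" for e
  have \<omega>: "\<omega> = (\<lambda>e. \<omega>' e + of_bool (e \<in> path_edges p))"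
    unfolding \<omega>'_def using p(2) by (intro ext) (auto simp: of_bool_def Suc_le_eq)
  have "flow m (insert y Y - {y}) \<omega>'"
    by (rule flow_remove[OF _ lattice_path_flow[OF p(1)]]) (use insert.prems \<omega> in auto)
  then have "flow m Y \<omega>'" using insert.hyps by simp
  then obtain P l' where P: "\<And>y. y \<in> Y \<Longrightarrow> lattice_path m y (l' y) (P y)"
    "\<omega>' = (\<lambda>e. card {y \<in> Y. e \<in> path_edges (P y)})"
    using insert.IH insert.prems by blast
  have "\<forall>z\<in>insert y Y. lattice_path m z ((l'(y := l)) z) ((P(y := p)) z)"
    using P(1) p(1) insert.hyps by auto
  moreover have "\<omega> = (\<lambda>e. card {z \<in> insert y Y. e \<in> path_edges ((P(y := p)) z)})"
  proof
    fix e
    have "{z \<in> Y. e \<in> path_edges ((P(y := p)) z)} = {z \<in> Y. e \<in> path_edges (P z)}" using insert.hyps by auto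
    then show "\<omega> e = card {z \<in> insert y Y. e \<in> path_edges ((P(y := p)) z)}"
      using insert.hyps by (subst \<omega>, subst card_filter_insert) (auto simp: P(2))
  qed
  ultimately show ?case by blast
qed

lemma flow_paths:
  assumes "finite Y" "Y \<subseteq> {1..m}" "\<forall>y\<in>Y. lattice_path m y (l y) (P y)"
  shows "flow m Y (\<lambda>e. card {y \<in> Y. e \<in> path_edges (P y)})"
  using assms
proof (induction Y rule: finite_induct)
  case empty
  show ?case using flow_zero by simp
next
  case (insert y Y)
  then show ?case
    using flow_add[of m Y "\<lambda>e. card {y \<in> Y. e \<in> path_edges (P y)}" "{y}" "\<lambda>e. of_bool (e \<in> path_edges (P y))"]
       lattice_path_flow[of m y "l y" "P y"]
    unfolding card_filter_insert[OF insert.hyps] using insert.hyps insert.prems by simp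
qed

lemma path_collections_bound:
  assumes "\<omega> \<in> path_collections m lam" "\<forall>k\<in>{1..m}. lam k < N" "\<omega> (a, b) \<noteq> 0"
  shows "fst a < N \<and> fst b < N"
proof -
  from assms(1) obtain P \<sigma> where \<sigma>: "\<sigma> permutes {1..m}" and P: "\<forall>y\<in>{1..m}. lattice_path m y (lam (\<sigma> y)) (P y)"
    and \<omega>: "\<omega> = (\<lambda>e. card {y \<in> {1..m}. e \<in> path_edges (P y)})"
    unfolding path_collections_def by blast
  from assms(3) obtain y where y: "y \<in> {1..m}" "(a, b) \<in> path_edges (P y)"
    unfolding \<omega> by (metis (mono_tags, lifting) card.empty empty_Collect_eq)
  then have "fst a \<le> fst b \<and> fst b \<le> lam (\<sigma> y)" using lattice_path_le P by blast
  moreover have "lam (\<sigma> y) < N" using assms(2) permutes_in_image[OF \<sigma>] y(1) by blast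
  ultimately show ?thesis by linarith
qed

text \<open>For distinct parts the path families can be forgotten. A decomposition of the flow has
  endpoints with the same multiplicities as the parts of \<open>lam\<close>, hence distinct ones, and the
  permutation matching rows with parts is read off from them.\<close>
lemma path_collections_eq:
  assumes inj: "inj_on lam {1..m}"
  shows "path_collections m lam = {\<omega>. flow m {1..m} \<omega> \<and>
     (\<forall>i. \<omega> ((i, int m), (i, int m + 1)) = card {k \<in> {1..m}. lam k = i}) \<and>
     (\<forall>i j. \<omega> ((i - 1, j), (i, j)) \<le> 1)}"
proof (intro equalityI subsetI)
  fix \<omega> assume "\<omega> \<in> path_collections m lam"
  then obtain P \<sigma> where \<sigma>: "\<sigma> permutes {1..m}" and P: "\<forall>y\<in>{1..m}. lattice_path m y (lam (\<sigma> y)) (P y)"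
    and \<omega>: "\<omega> = (\<lambda>e. card {y \<in> {1..m}. e \<in> path_edges (P y)})" and h: "\<forall>i j. \<omega> ((i - 1, j), (i, j)) \<le> 1"
    unfolding path_collections_def by blast
  have "flow m {1..m} \<omega>"
    unfolding \<omega> by (rule flow_paths[where l = "\<lambda>y. lam (\<sigma> y)"]) (use P in auto)
  moreover have "\<omega> ((i, int m), (i, int m + 1)) = card {k \<in> {1..m}. lam k = i}" for i
  proof -
    have "\<omega> ((i, int m), (i, int m + 1)) = card {y \<in> {1..m}. lam (\<sigma> y) = i}"
      unfolding \<omega> using lattice_path_top[OF P[rule_format], of _ i]
      by (intro arg_cong[of _ _ card] Collect_cong conj_cong refl) auto
    also have "{y \<in> {1..m}. lam (\<sigma> y) = i} = inv \<sigma> ` {k \<in> {1..m}. lam k = i}"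
      using \<sigma> permutes_in_image[OF \<sigma>] permutes_in_image[OF permutes_inv[OF \<sigma>]] permutes_inverses[OF \<sigma>]
      by (auto simp: image_iff) metis
    also have "card \<dots> = card {k \<in> {1..m}. lam k = i}"
      by (rule card_image) (metis \<sigma> permutes_inj permutes_inv inj_on_subset subset_UNIV)
    finally show ?thesis .
  qed
  ultimately show "\<omega> \<in> {\<omega>. flow m {1..m} \<omega> \<and>
     (\<forall>i. \<omega> ((i, int m), (i, int m + 1)) = card {k \<in> {1..m}. lam k = i}) \<and>
     (\<forall>i j. \<omega> ((i - 1, j), (i, j)) \<le> 1)}" using h by blast
next
  fix \<omega> assume "\<omega> \<in> {\<omega>. flow m {1..m} \<omega> \<and>
     (\<forall>i. \<omega> ((i, int m), (i, int m + 1)) = card {k \<in> {1..m}. lam k = i}) \<and>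
     (\<forall>i j. \<omega> ((i - 1, j), (i, j)) \<le> 1)}"
  then have fl: "flow m {1..m} \<omega>" and top: "\<And>i. \<omega> ((i, int m), (i, int m + 1)) = card {k \<in> {1..m}. lam k = i}"
    and h: "\<forall>i j. \<omega> ((i - 1, j), (i, j)) \<le> 1" by auto
  obtain P l where P: "\<And>y. y \<in> {1..m} \<Longrightarrow> lattice_path m y (l y) (P y)"
     and \<omega>: "\<omega> = (\<lambda>e. card {y \<in> {1..m}. e \<in> path_edges (P y)})"
    using flow_decompose[OF finite_atLeastAtMost subset_refl fl] by blast
  have cards: "card {y \<in> {1..m}. l y = i} = card {k \<in> {1..m}. lam k = i}" for i
    unfolding top[symmetric] \<omega> using lattice_path_top[OF P, of _ i]
    by (intro arg_cong[of _ _ card] Collect_cong conj_cong refl) auto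
  have le1: "card {k \<in> {1..m}. lam k = i} \<le> 1" for i
  proof -
    have "card {k \<in> {1..m}. lam k = i} \<le> Suc 0"
      by (subst card_le_Suc0_iff_eq) (simp, metis (mono_tags, lifting) inj inj_onD mem_Collect_eq)
    then show ?thesis by simp
  qed
  have "inj_on l {1..m}"
  proof (rule inj_onI)
    fix x y assume xy: "x \<in> {1..m}" "y \<in> {1..m}" "l x = l y"
    have "card {z \<in> {1..m}. l z = l y} \<le> Suc 0" using cards le1 by simp
    then show "x = y" using xy by (subst (asm) card_le_Suc0_iff_eq) auto
  qed
  moreover have "l ` {1..m} = lam ` {1..m}"
  proof -
    have iff: "i \<in> f ` {1..m} \<longleftrightarrow> card {y \<in> {1..m}. f y = i} \<noteq> 0" for f :: "nat \<Rightarrow> int" and i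
      by auto
    show ?thesis by (intro set_eqI) (simp only: iff cards)
  qed
  ultimately have "bij_betw (the_inv_into {1..m} lam \<circ> l) {1..m} {1..m}"
    using inj by (intro bij_betw_trans[of l _ "lam ` {1..m}"] bij_betw_the_inv_into) (auto simp: bij_betw_def)
  then have \<sigma>: "(\<lambda>y. if y \<in> {1..m} then (the_inv_into {1..m} lam \<circ> l) y else y) permutes {1..m}" (is "?\<sigma> permutes _")
    by (intro bij_imp_permutes) (erule bij_betw_cong[THEN iffD1, rotated], simp, auto)
  have "lam (?\<sigma> y) = l y" if "y \<in> {1..m}" for y
  proof -
    have "l y \<in> lam ` {1..m}" using that \<open>l ` {1..m} = lam ` {1..m}\<close> by (metis imageI)
    then show ?thesis using that f_the_inv_into_f[OF inj] by simp
  qed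
  then have "\<forall>y\<in>{1..m}. lattice_path m y (lam (?\<sigma> y)) (P y)" using P by metis
  then show "\<omega> \<in> path_collections m lam"
    unfolding path_collections_def using \<sigma> \<omega> h by blast
qed

section \<open>The sum over path collections, column by column\<close>

text \<open>Both the bit patterns of one column boundary and the sequences of such patterns are words.\<close>
definition words :: "'a set \<Rightarrow> nat \<Rightarrow> 'a list set" where
  "words A n = {xs. set xs \<subseteq> A \<and> length xs = n}"

lemma finite_words: "finite A \<Longrightarrow> finite (words A n)"
  unfolding words_def by (rule finite_lists_length_eq)

lemma words_0: "words A 0 = {[]}"
  by (auto simp: words_def)

lemma sum_words_Suc: "(\<Sum>xs\<in>words A (Suc n). f xs) = (\<Sum>a\<in>A. \<Sum>xs\<in>words A n. f (a # xs))"
proof -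
  have "(\<Sum>xs\<in>words A (Suc n). f xs) = (\<Sum>(xs, a)\<in>words A n \<times> A. f (a # xs))"
    unfolding words_def lists_length_Suc_eq by (subst sum.reindex) (auto simp: inj_on_def case_prod_unfold)
  then show ?thesis by (simp add: sum.cartesian_product[symmetric] sum.swap[of _ A])
qed

context fixes s q :: complex
begin

text \<open>The weight of a column for given outgoing bits. The vertical arrow counts need not be summed over:
  they follow from the bits by conservation.\<close>
fun bit_column_weight :: "rows \<Rightarrow> nat \<Rightarrow> nat \<Rightarrow> bool list \<Rightarrow> complex" where
  "bit_column_weight [] g n bs = (if g = n then 1 else 0)"
| "bit_column_weight ((u, a) # R) g n bs =
     row_weight s q u g a (hd bs) * bit_column_weight R (g + of_bool a - of_bool (hd bs)) n (tl bs)"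

lemma column_expand:
  "column s q R g n K = (\<Sum>bs\<in>words UNIV (length R). bit_column_weight R g n bs * K (zip (map fst R) bs))"
proof (induction R arbitrary: g K)
  case (Cons r R)
  obtain u a where "r = (u, a)" by (cases r)
  then show ?case by (simp add: sum_words_Suc Cons sum_distrib_left mult.assoc)
qed (simp add: words_0)

lemma strip_expand:
  assumes "length as = length us"
  shows "strip s q ns (zip us as) = (\<Sum>H\<in>words (words UNIV (length us)) (length ns).
     (\<Prod>x<length ns. bit_column_weight (zip us ((as # H) ! x)) 0 (ns ! x) (H ! x)) *
     of_bool (True \<notin> set ((as # H) ! length ns)))"
  using assms
proof (induction ns arbitrary: as)
  case Nil
  have "(\<exists>r\<in>set (zip us as). snd r) \<longleftrightarrow> True \<in> set as"
    using Nil by (auto simp: set_zip in_set_conv_nth)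
  then show ?case by (simp add: words_0)
next
  case (Cons n ns)
  have "strip s q (n # ns) (zip us as) = (\<Sum>bs\<in>words UNIV (length us). bit_column_weight (zip us as) 0 n bs * strip s q ns (zip us bs))"
    using Cons.prems by (simp add: column_expand)
  also have "\<dots> = (\<Sum>bs\<in>words UNIV (length us). \<Sum>H\<in>words (words UNIV (length us)) (length ns). 
     (\<Prod>x<Suc (length ns). bit_column_weight (zip us ((as # bs # H) ! x)) 0 ((n # ns) ! x) ((bs # H) ! x)) *
     of_bool (True \<notin> set ((bs # H) ! length ns)))"
    by (intro sum.cong refl, subst Cons.IH)
       (simp_all add: words_def prod.lessThan_Suc_shift sum_distrib_left mult.assoc del: prod.lessThan_Suc)
  finally show ?case by (simp add: sum_words_Suc del: prod.lessThan_Suc)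
qed

lemma bit_column_weight_eq:
  assumes "length bs = length R" "V 0 = g" "V (length R) = n"
    "\<And>j. j < length R \<Longrightarrow> V (Suc j) + of_bool (bs ! j) = V j + of_bool (snd (R ! j))"
  shows "bit_column_weight R g n bs = (\<Prod>j<length R.
     vertex_weight s q (fst (R ! j)) (V j) (of_bool (snd (R ! j))) (V (Suc j)) (of_bool (bs ! j)))"
  using assms
proof (induction R arbitrary: g V bs)
  case (Cons r R)
  obtain u a where r: "r = (u, a)" by (cases r)
  obtain b bs' where bs: "bs = b # bs'" using Cons.prems(1) by (cases bs) auto
  have V1: "V 1 = g + of_bool a - of_bool b" using Cons.prems(2) Cons.prems(4)[of 0] by (simp add: r bs)
  have "bit_column_weight R (V 1) n bs' = (\<Prod>j<length R.
     vertex_weight s q (fst (R ! j)) (V (Suc j)) (of_bool (snd (R ! j))) (V (Suc (Suc j))) (of_bool (bs' ! j)))"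
  proof (rule Cons.IH[where V = "\<lambda>j. V (Suc j)"])
    fix j assume "j < length R"
    then show "V (Suc (Suc j)) + of_bool (bs' ! j) = V (Suc j) + of_bool (snd (R ! j))"
      using Cons.prems(4)[of "Suc j"] by (simp add: bs)
  qed (use Cons.prems bs in auto)
  then show ?case
    by (simp add: r bs prod.lessThan_Suc_shift row_weight_def V1[symmetric] Cons.prems(2) del: prod.lessThan_Suc)
qed simp

text \<open>A nonzero weight excludes a vertex that sends out an arrow without receiving one, which is the
  only way in which the running count of vertical arrows can fail to be conserved.\<close>
lemma bit_column_weight_nonzero:
  assumes "length bs = length R" "bit_column_weight R g n bs \<noteq> 0"
  obtains V where "V 0 = g" "V (length R) = n"
    "\<And>j. j < length R \<Longrightarrow> V (Suc j) + of_bool (bs ! j) = V j + of_bool (snd (R ! j))"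
proof -
  have "\<exists>V. V 0 = g \<and> V (length R) = n \<and>
    (\<forall>j<length R. V (Suc j) + of_bool (bs ! j) = V j + of_bool (snd (R ! j)))"
    using assms
  proof (induction R arbitrary: g bs)
    case Nil
    then show ?case by (auto split: if_splits)
  next
    case (Cons r R)
    obtain u a where r: "r = (u, a)" by (cases r)
    obtain b bs' where bs: "bs = b # bs'" using Cons.prems(1) by (cases bs) auto
    let ?g = "g + of_bool a - of_bool b"
    have nz: "row_weight s q u g a b \<noteq> 0" "bit_column_weight R ?g n bs' \<noteq> 0" using Cons.prems(2) by (auto simp: r bs)
    have g: "?g + of_bool b = g + of_bool a"
      using nz(1) by (cases a; cases b; cases g) (auto simp: row_weight_simps)
    obtain V where V: "V 0 = ?g" "V (length R) = n"
      "\<forall>j<length R. V (Suc j) + of_bool (bs' ! j) = V j + of_bool (snd (R ! j))"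
      using Cons.IH[OF _ nz(2)] Cons.prems(1) bs by auto
    show ?case
    proof (intro exI[of _ "case_nat g V"] conjI allI impI)
      fix j assume "j < length (r # R)"
      then show "case_nat g V (Suc j) + of_bool (bs ! j) = case_nat g V j + of_bool (snd ((r # R) ! j))"
        using V g by (cases j) (auto simp: bs r)
    qed (use V in auto)
  qed
  then show ?thesis using that by blast
qed

end

text \<open>From the bottom up, conservation determines the vertical arrows from the horizontal ones.\<close>
lemma flow_ext:
  assumes "flow m Y \<omega>" "flow m Y \<omega>'"
    and h: "\<And>i j. 0 \<le> i \<Longrightarrow> 1 \<le> j \<Longrightarrow> j \<le> int m \<Longrightarrow> \<omega> ((i - 1, j), (i, j)) = \<omega>' ((i - 1, j), (i, j))"
  shows "\<omega> = \<omega>'"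
proof
  fix e :: "point \<times> point"
  obtain i j b where e: "e = ((i, j), b)" by (metis prod.exhaust)
  have v: "\<omega> ((i, int k), (i, int k + 1)) = \<omega>' ((i, int k), (i, int k + 1))" if "0 \<le> i" "k \<le> m" for i k
    using that(2)
  proof (induction k)
    case 0
    have "\<omega> ((i, int 0), (i, int 0 + 1)) = 0" "\<omega>' ((i, int 0), (i, int 0 + 1)) = 0"
      using flowD(2)[OF assms(1), of "(i, 0)"] flowD(2)[OF assms(2), of "(i, 0)"] by auto
    then show ?case by simp
  next
    case (Suc k)
    have "inflow \<omega> i (int (Suc k)) = outflow \<omega> i (int (Suc k))" "inflow \<omega>' i (int (Suc k)) = outflow \<omega>' i (int (Suc k))"
      using flowD(6)[OF assms(1), of i "int (Suc k)"] flowD(6)[OF assms(2), of i "int (Suc k)"] Suc.prems that(1) by auto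
    then show ?case
      using h[of i "int (Suc k)"] h[of "i + 1" "int (Suc k)"] Suc that(1)
      by (simp add: inflow_def outflow_def add.commute)
  qed
  show "\<omega> e = \<omega>' e"
  proof (cases "up_right_step (i, j) b \<and> 1 \<le> j \<and> j \<le> int m \<and> 0 \<le> fst b")
    case False
    then have "\<omega> e = 0" "\<omega>' e = 0" using flowD(1-4)[OF assms(1), of "(i, j)" b] flowD(1-4)[OF assms(2), of "(i, j)" b]
      unfolding e by fastforce+
    then show ?thesis by simp
  next
    case True
    then consider "b = (i + 1, j)" | "b = (i, j + 1)" by (auto simp: up_right_step_def)
    then show ?thesis
    proof cases
      case 1
      then show ?thesis using h[of "i + 1" j] True by (simp add: e)
    next
      case 2
      then show ?thesis using v[of i "nat j"] True by (simp add: e nat_le_iff)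
    qed
  qed
qed

text \<open>The arrow counts with horizontal bits \<open>G\<close> and vertical counts \<open>V\<close>. Column boundary \<open>x\<close> is the left
  side of column \<open>x\<close>, and list position \<open>j\<close> belongs to row \<open>j + 1\<close>; \<open>V x j\<close> counts the arrows
  leaving row \<open>j\<close> upwards in column \<open>x\<close>.\<close>
definition arrows_of :: "nat \<Rightarrow> nat \<Rightarrow> bool list list \<Rightarrow> (nat \<Rightarrow> nat \<Rightarrow> nat) \<Rightarrow> arrows" where
  "arrows_of m N G V = (\<lambda>((i, j), (i', j')).
     if 1 \<le> j \<and> j \<le> int m then
       if i' = i + 1 \<and> j' = j \<and> 0 \<le> i' \<and> i' \<le> int N then of_bool (G ! nat i' ! nat (j - 1))
       else if i' = i \<and> j' = j + 1 \<and> 0 \<le> i \<and> i < int N then V (nat i) (nat j)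
       else 0
     else 0)"

lemma arrows_of_flow:
  assumes G0: "\<And>j. j < m \<Longrightarrow> G ! 0 ! j" and GN: "\<And>j. j < m \<Longrightarrow> \<not> G ! N ! j"
    and V0: "\<And>x. x < N \<Longrightarrow> V x 0 = 0"
    and V: "\<And>x j. x < N \<Longrightarrow> j < m \<Longrightarrow> V x (Suc j) + of_bool (G ! Suc x ! j) = V x j + of_bool (G ! x ! j)"
  shows "flow m {1..m} (arrows_of m N G V)"
proof -
  have "inflow (arrows_of m N G V) i j = outflow (arrows_of m N G V) i j" if ij: "0 \<le> i" "1 \<le> j" "j \<le> int m" for i j
  proof -
    obtain x k where x: "i = int x" and k: "j = int (Suc k)"
      by (rule that[of "nat i" "nat (j - 1)"]) (use ij in auto)
    have km: "k < m" using ij k by auto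
    show ?thesis
    proof (cases "x < N")
      case True
      then have "nat (int x + 1) = Suc x" by simp
      with True show ?thesis using V[OF True km] V0[OF True] km
        by (cases k) (auto simp: inflow_def outflow_def arrows_of_def x k nat_add_distrib)
    next
      case False
      then show ?thesis using GN[OF km] km
        by (cases "x = N") (auto simp: inflow_def outflow_def arrows_of_def x k)
    qed
  qed
  moreover have "up_right_step a b \<and> 1 \<le> snd a \<and> snd a \<le> int m \<and> 0 \<le> fst b" if "arrows_of m N G V (a, b) \<noteq> 0" for a b
    using that by (cases a; cases b) (auto simp: arrows_of_def up_right_step_def split: if_splits)
  moreover have "arrows_of m N G V ((-1, int j), (0, int j)) = of_bool (j \<in> {1..m})" if "j \<in> {1..m}" for j
  proof -
    have "nat (int j - 1) < m" using that by auto
    then show ?thesis using that G0[of "nat (int j - 1)"] by (auto simp: arrows_of_def)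
  qed
  moreover have "\<forall>a b. int N \<le> fst a \<longrightarrow> arrows_of m N G V (a, b) = 0"
    by (auto simp: arrows_of_def)
  ultimately show ?thesis unfolding flow_def by blast
qed

text \<open>Recording the bits on the column boundaries \<open>1, ..., N\<close> embeds the path collections into the index
  set of the expanded column-wise sum and preserves weights. Bit patterns outside the image have
  weight zero, because a nonzero weight yields vertical counts, hence a flow, hence paths.\<close>
lemma F_sf_eq:
  assumes inj: "inj_on lam {1..m}" and lam: "\<forall>k\<in>{1..m}. 0 \<le> lam k \<and> lam k < int N"
    and ne: "\<forall>j\<in>{1..m}. 1 - s * u j \<noteq> 0"
  shows "F_sf s q m lam u =
    occupation_F s q (map (\<lambda>x. card {k \<in> {1..m}. lam k = int x}) [0..<N]) (map u [1..<Suc m])"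
proof -
  define us where "us = map u [1..<Suc m]"
  define as where "as = replicate m True"
  define ns where "ns = map (\<lambda>x. card {k \<in> {1..m}. lam k = int x}) [0..<N]"
  define wt where "wt H = (\<Prod>x<N. bit_column_weight s q (zip us ((as # H) ! x)) 0 (ns ! x) (H ! x)) *
     of_bool (True \<notin> set ((as # H) ! N))" for H
  define grids where "grids = words (words (UNIV :: bool set) m) N"
  define Hof where "Hof \<omega> = map (\<lambda>x. map (\<lambda>j. \<omega> ((int x, int j + 1), (int x + 1, int j + 1)) = 1) [0..<m]) [0..<N]" for \<omega> :: arrows
  define W where "W \<omega> = Prod_any (\<lambda>i::nat. \<Prod>j\<in>{1..m}. local_weight s q (u j) \<omega> (int i) (int j))" for \<omega>
  have us: "length us = m" "\<And>j. j < m \<Longrightarrow> us ! j = u (Suc j)" by (simp_all add: us_def del: upt_Suc)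
  have full: "full us = zip us as"
    by (rule nth_equalityI) (auto simp: us as_def)
  have F: "occupation_F s q ns us = (\<Sum>H\<in>grids. wt H)"
    unfolding occupation_F_def full wt_def grids_def by (subst strip_expand) (simp_all add: us as_def ns_def)
  have gridD: "length H = N" "x < N \<Longrightarrow> length (H ! x) = m" if "H \<in> grids" for H x
    using that unfolding grids_def words_def by (auto simp: subset_iff)
  have rowD: "length ((as # H) ! x) = m" if "H \<in> grids" "x \<le> N" for H x
    using gridD[OF that(1)] that(2) by (cases x) (auto simp: as_def)

  have \<Omega>: "flow m {1..m} \<omega>" "\<And>i. \<omega> ((i, int m), (i, int m + 1)) = card {k \<in> {1..m}. lam k = i}"
     "\<And>i j. \<omega> ((i - 1, j), (i, j)) \<le> 1" "\<And>a b. \<omega> (a, b) \<noteq> 0 \<Longrightarrow> fst a < int N \<and> fst b < int N"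
     if "\<omega> \<in> path_collections m lam" for \<omega>
    using that path_collections_bound[OF that, of "int N"] lam unfolding path_collections_eq[OF inj] by auto
  have Hof: "(as # Hof \<omega>) ! x ! j \<longleftrightarrow> \<omega> ((int x - 1, int j + 1), (int x, int j + 1)) = 1"
    if "\<omega> \<in> path_collections m lam" "x \<le> N" "j < m" for \<omega> x j
  proof (cases x)
    case 0
    then show ?thesis using flowD(5)[OF \<Omega>(1)[OF that(1)], of "Suc j"] that(3) by (simp add: as_def add.commute)
  next
    case (Suc x')
    then show ?thesis using that(2,3) by (simp add: Hof_def add.commute)
  qed
  have Hof_bool: "of_bool ((as # Hof \<omega>) ! x ! j) = \<omega> ((int x - 1, int j + 1), (int x, int j + 1))"
    if "\<omega> \<in> path_collections m lam" "x \<le> N" "j < m" for \<omega> x j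
    using Hof[OF that] \<Omega>(3)[OF that(1), of "int x" "int j + 1"] by auto
  have Hof_grid: "Hof \<omega> \<in> grids" for \<omega>
    by (auto simp: Hof_def grids_def words_def)

  have "inj_on Hof (path_collections m lam)"
  proof (rule inj_onI)
    fix \<omega> \<omega>' assume w: "\<omega> \<in> path_collections m lam" "\<omega>' \<in> path_collections m lam" "Hof \<omega> = Hof \<omega>'"
    show "\<omega> = \<omega>'"
    proof (rule flow_ext[OF \<Omega>(1)[OF w(1)] \<Omega>(1)[OF w(2)]])
      fix i j :: int assume ij: "0 \<le> i" "1 \<le> j" "j \<le> int m"
      show "\<omega> ((i - 1, j), (i, j)) = \<omega>' ((i - 1, j), (i, j))"
      proof (cases "i \<le> int N")
        case True
        then show ?thesis
          using Hof_bool[OF w(1), of "nat i" "nat (j - 1)"] Hof_bool[OF w(2), of "nat i" "nat (j - 1)"] w(3) ij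
          by (simp add: nat_le_iff nat_less_iff)
      next
        case False
        then have "\<omega> ((i - 1, j), (i, j)) = 0" "\<omega>' ((i - 1, j), (i, j)) = 0"
          using \<Omega>(4)[OF w(1), of "(i - 1, j)" "(i, j)"] \<Omega>(4)[OF w(2), of "(i - 1, j)" "(i, j)"] by fastforce+
        then show ?thesis by simp
      qed
    qed
  qed
  moreover have "wt (Hof \<omega>) = W \<omega>" if w: "\<omega> \<in> path_collections m lam" for \<omega>
  proof -
    have last: "True \<notin> set ((as # Hof \<omega>) ! N)"
    proof
      assume "True \<in> set ((as # Hof \<omega>) ! N)"
      then obtain j where j: "j < m" "(as # Hof \<omega>) ! N ! j"
        using rowD[OF Hof_grid, of N \<omega>] by (auto simp: in_set_conv_nth)
      then have "\<omega> ((int N - 1, int j + 1), (int N, int j + 1)) \<noteq> 0" using Hof[OF w, of N j] by simp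
      then show False using \<Omega>(4)[OF w] by fastforce
    qed
    have col: "bit_column_weight s q (zip us ((as # Hof \<omega>) ! x)) 0 (ns ! x) (Hof \<omega> ! x) =
       (\<Prod>j\<in>{1..m}. local_weight s q (u j) \<omega> (int x) (int j))" if x: "x < N" for x
    proof -
      define V where "V j = \<omega> ((int x, int j), (int x, int j + 1))" for j
      let ?R = "zip us ((as # Hof \<omega>) ! x)"
      have len: "length ?R = m" using rowD[OF Hof_grid, of x \<omega>] x us by simp
      have R: "fst (?R ! j) = u (Suc j)" "of_bool (snd (?R ! j)) = \<omega> ((int x - 1, int j + 1), (int x, int j + 1))" 
         "of_bool (Hof \<omega> ! x ! j) = \<omega> ((int x, int j + 1), (int x + 1, int j + 1))"if "j < m" for j
        using that len us x Hof_bool[OF w, of x j] Hof_bool[OF w, of "Suc x" j] by (auto simp: add.commute)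
      have V0: "V 0 = 0" using flowD(2)[OF \<Omega>(1)[OF w], of "(int x, 0)" "(int x, 1)"] by (auto simp: V_def)
      have VS: "V (Suc j) + of_bool (Hof \<omega> ! x ! j) = V j + of_bool (snd (?R ! j))" if "j < m" for j
        using flowD(6)[OF \<Omega>(1)[OF w], of "int x" "int (Suc j)"] that
        by (simp add: R[OF that] V_def inflow_def outflow_def add.commute)
      have "bit_column_weight s q ?R 0 (ns ! x) (Hof \<omega> ! x) = (\<Prod>j<length ?R.
          vertex_weight s q (fst (?R ! j)) (V j) (of_bool (snd (?R ! j))) (V (Suc j)) (of_bool (Hof \<omega> ! x ! j)))"
      proof (rule bit_column_weight_eq)
        show "length (Hof \<omega> ! x) = length ?R" using len gridD(2)[OF Hof_grid x] by simp
        show "V (length ?R) = ns ! x" unfolding len using \<Omega>(2)[OF w] x by (simp add: V_def ns_def)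
        show "V (Suc j) + of_bool (Hof \<omega> ! x ! j) = V j + of_bool (snd (?R ! j))" if "j < length ?R" for j
          by (rule VS) (use that in \<open>simp only: len\<close>)
      qed (rule V0)
      also have "\<dots> = (\<Prod>j<m. vertex_weight s q (fst (?R ! j)) (V j) (of_bool (snd (?R ! j))) (V (Suc j)) (of_bool (Hof \<omega> ! x ! j)))"
        unfolding len ..
      also have "\<dots> = (\<Prod>j<m. local_weight s q (u (Suc j)) \<omega> (int x) (int (Suc j)))"
        by (intro prod.cong refl) (simp add: R local_weight_def V_def add.commute)
      also have "\<dots> = (\<Prod>j\<in>{1..m}. local_weight s q (u j) \<omega> (int x) (int j))"
        by (simp add: prod.atLeast1_atMost_eq)
      finally show ?thesis .
    qed
    have "W \<omega> = (\<Prod>x\<in>{..<N}. \<Prod>j\<in>{1..m}. local_weight s q (u j) \<omega> (int x) (int j))"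
      unfolding W_def
    proof (rule Prod_any.expand_superset)
      have "local_weight s q (u j) \<omega> (int x) (int j) = 1" if "\<not> x < N" "j \<in> {1..m}" for x j
      proof -
        have z: "\<omega> (a, b) = 0" if "int x \<le> fst b \<or> int x \<le> fst a" for a b
          using \<Omega>(4)[OF w, of a b] that \<open>\<not> x < N\<close> by fastforce
        show ?thesis using ne that(2) by (simp add: local_weight_def z vertex_weight_def)
      qed
      then show "{x. (\<Prod>j\<in>{1..m}. local_weight s q (u j) \<omega> (int x) (int j)) \<noteq> 1} \<subseteq> {..<N}"
        by (auto intro: ccontr prod.neutral)
    qed simp
    then show ?thesis using last by (simp add: wt_def col)
  qed
  moreover have "wt H = 0" if H: "H \<in> grids" "H \<notin> Hof ` path_collections m lam" for H
  proof (rule ccontr)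
    assume nz: "wt H \<noteq> 0"
    define G where "G = as # H"
    have last: "True \<notin> set (G ! N)" using nz by (auto simp: wt_def G_def)
    have col: "bit_column_weight s q (zip us (G ! x)) 0 (ns ! x) (H ! x) \<noteq> 0" if "x < N" for x
      using nz that by (auto simp: wt_def G_def)
    have len: "length (G ! x) = m" if "x \<le> N" for x using rowD[OF H(1) that] by (simp add: G_def)
    have "\<exists>V. V 0 = 0 \<and> V m = ns ! x \<and> (\<forall>j<m. V (Suc j) + of_bool (G ! Suc x ! j) = V j + of_bool (G ! x ! j))" if x: "x < N" for x
    proof -
      have lens: "length (G ! x) = m" "length (H ! x) = length (zip us (G ! x))"
        using len[of x] x us(1) gridD(2)[OF H(1) x] by simp_all
      obtain V where "V 0 = 0" "V (length (zip us (G ! x))) = ns ! x"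
        "\<And>j. j < length (zip us (G ! x)) \<Longrightarrow> V (Suc j) + of_bool (H ! x ! j) = V j + of_bool (snd (zip us (G ! x) ! j))"
        using bit_column_weight_nonzero[OF lens(2) col[OF x]] by blast
      then show ?thesis using lens(1) us(1) by (intro exI[of _ V]) (simp add: G_def)
    qed
    then obtain V where V: "\<And>x. x < N \<Longrightarrow> V x 0 = 0" "\<And>x. x < N \<Longrightarrow> V x m = ns ! x"
       "\<And>x j. x < N \<Longrightarrow> j < m \<Longrightarrow> V x (Suc j) + of_bool (G ! Suc x ! j) = V x j + of_bool (G ! x ! j)"
      by metis
    define \<omega> where "\<omega> = arrows_of m N G V"
    have fl: "flow m {1..m} \<omega>"
      unfolding \<omega>_def
    proof (rule arrows_of_flow)
      show "\<not> G ! N ! j" if "j < m" for j using last len[of N] that by (metis le_refl nth_mem)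
    qed (use V in \<open>auto simp: G_def as_def\<close>)
    moreover have "\<omega> ((i, int m), (i, int m + 1)) = card {k \<in> {1..m}. lam k = i}" for i
    proof (cases "0 \<le> i \<and> i < int N")
      case True
      then show ?thesis using V(1,2)[of "nat i"] by (cases m) (auto simp: \<omega>_def arrows_of_def ns_def nat_less_iff nat_add_distrib)
    next
      case False
      then have "{k \<in> {1..m}. lam k = i} = {}" using lam by auto
      then show ?thesis using False by (auto simp: \<omega>_def arrows_of_def)
    qed
    moreover have "\<omega> ((i - 1, j), (i, j)) \<le> 1" for i j
      by (auto simp: \<omega>_def arrows_of_def)
    ultimately have "\<omega> \<in> path_collections m lam"
      unfolding path_collections_eq[OF inj] by blast
    moreover have "Hof \<omega> = H"
    proof (rule nth_equalityI)
      fix x assume "x < length (Hof \<omega>)"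
      then have x: "x < N" by (simp add: Hof_def)
      show "Hof \<omega> ! x = H ! x"
        using x gridD(2)[OF H(1) x]
        by (intro nth_equalityI) (auto simp: Hof_def \<omega>_def arrows_of_def G_def nat_add_distrib)
    qed (simp add: gridD(1)[OF H(1)] Hof_def)
    ultimately show False using H(2) by blast
  qed
  moreover have "finite grids" unfolding grids_def by (intro finite_words) simp
  ultimately have "(\<Sum>\<omega>\<in>path_collections m lam. W \<omega>) = (\<Sum>H\<in>grids. wt H)"
    by (intro sum.reindex_cong[of Hof _ "Hof ` path_collections m lam" wt W, symmetric, THEN trans] sum.mono_neutral_left)
       (use Hof_grid in auto)
  then show ?thesis unfolding F_sf_def W_def[symmetric] F[symmetric] ns_def us_def .
qed

section \<open>The eigenrelation\<close>

lemma T_prod_eq: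
  assumes "finite I"
  shows "T_prod s I G u = G (\<lambda>i. if i \<in> I then s else u i)"
proof -
  have "foldr (T_op s) xs G u = G (\<lambda>i. if i \<in> set xs then s else u i)" for xs
  proof (induction xs arbitrary: u)
    case (Cons x xs)
    have "(\<lambda>i. if i \<in> set xs then s else (u(x := s)) i) = (\<lambda>i. if i \<in> set (x # xs) then s else u i)"
      by auto
    then show ?case using Cons by (simp add: T_op_def[of s x])
  qed simp
  then show ?thesis using assms by (simp add: T_prod_def)
qed

lemma F_stair_eq:
  assumes "\<forall>j\<in>{1..k}. 1 - s * v j \<noteq> 0"
  shows "F_stair s q k v = occupation_F s q (replicate k 1) (map v [1..<Suc k])"
proof -
  have "{i \<in> {1..k}. int k - int i = int x} = {k - x}" if "x < k" for x
    using that by auto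
  then have "map (\<lambda>x. card {i \<in> {1..k}. int k - int i = int x}) [0..<k] = replicate k 1"
    by (intro nth_equalityI) auto
  then show ?thesis
    unfolding F_stair_def by (subst F_sf_eq[where N = k]) (use assms in \<open>auto simp: inj_on_def\<close>)
qed

lemma mset_upto: "mset [1..<Suc m] = mset_set {1..m}"
  by (simp only: mset_upt atLeastLessThanSuc_atLeastAtMost)

lemma F_stair_restrict:
  assumes "card I = k" "finite I" "\<forall>i\<in>I. 1 - s * u i \<noteq> 0"
  shows "F_stair s q k (restrict_vars I u) = set_F s q (replicate k 1) u I"
proof -
  have len: "length (sorted_list_of_set I) = k" using assms by simp
  have "map (restrict_vars I u) [1..<Suc k] = map u (sorted_list_of_set I)"
    using len by (intro nth_equalityI) (auto simp: restrict_vars_def simp del: upt_Suc)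
  moreover have "\<forall>j\<in>{1..k}. 1 - s * restrict_vars I u j \<noteq> 0"
  proof
    fix j assume "j \<in> {1..k}"
    then have "sorted_list_of_set I ! (j - 1) \<in> set (sorted_list_of_set I)"
      using len by (intro nth_mem) auto
    then show "1 - s * restrict_vars I u j \<noteq> 0" using assms by (simp add: restrict_vars_def)
  qed
  ultimately show ?thesis by (simp only: F_stair_eq set_F_def)
qed

lemma strict_signature:
  assumes lam: "lam \<in> Sign_plus m" and strict: "\<forall>i\<in>{1..m - 1}. lam i > lam (i + 1)"
  shows "\<And>i j. 1 \<le> i \<Longrightarrow> i < j \<Longrightarrow> j \<le> m \<Longrightarrow> lam j < lam i"
    and "inj_on lam {1..m}"
    and "\<And>j. j < m \<Longrightarrow> int j \<le> lam (m - j)"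
proof -
  show *: "lam j < lam i" if "1 \<le> i" "i < j" "j \<le> m" for i j
    using that(2,3)
  proof (induction j)
    case (Suc j)
    have "lam (Suc j) < lam j" using strict Suc.prems that(1) by auto
    then show ?case using Suc by (cases "i = j") auto
  qed simp
  show "inj_on lam {1..m}"
    by (rule linorder_inj_onI) (use * in force)+
  show "int j \<le> lam (m - j)" if "j < m" for j
    using that
  proof (induction j)
    case 0
    then show ?case using lam by (auto simp: Sign_plus_def)
  next
    case (Suc j)
    have "lam (m - j) < lam (m - Suc j)" using Suc.prems by (intro *) auto
    then show ?case using Suc by auto
  qed
qed

text \<open>Since \<open>lam (m - j) \<ge> j\<close> in a strict signature, the value \<open>j\<close> can only be taken at an index
  \<open>m - j'\<close> with \<open>j' \<le> j\<close>, and smaller \<open>j'\<close> are used up by smaller values.\<close>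
lemma staircase_iff:
  assumes lam: "lam \<in> Sign_plus m" and strict: "\<forall>i\<in>{1..m - 1}. lam i > lam (i + 1)" and "k \<le> m"
  shows "(\<forall>j<k. lam (m - j) = int j) \<longleftrightarrow> (\<forall>j<k. int j \<in> lam ` {1..m})"
proof (intro iffI allI impI)
  fix j assume "\<forall>j<k. lam (m - j) = int j" "j < k"
  then have "lam (m - j) = int j" "m - j \<in> {1..m}" using assms(3) by auto
  then show "int j \<in> lam ` {1..m}" by force
next
  fix j assume im: "\<forall>j<k. int j \<in> lam ` {1..m}" and "j < k"
  then show "lam (m - j) = int j"
  proof (induction j rule: less_induct)
    case (less j)
    obtain i where i: "i \<in> {1..m}" "lam i = int j" using less.prems by (metis imageE)
    define j' where "j' = m - i"
    have j': "i = m - j'" "j' < m" using i by (auto simp: j'_def)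
    have "int j' \<le> int j" using strict_signature(3)[OF lam strict j'(2)] i j' by simp
    moreover have "\<not> j' < j" using less.IH[of j'] less.prems i j' by auto
    ultimately show ?case using i j' by simp
  qed
qed

theorem lemma3p4:
  fixes m k :: nat and lam :: "nat \<Rightarrow> int" and s q :: complex and u :: "nat \<Rightarrow> complex"
  assumes "m \<ge> 1" and "k \<in> {1..m}"
    and "lam \<in> Sign_plus m" and "\<forall>i\<in>{1..m - 1}. lam i > lam (i + 1)"
    and "s \<noteq> 0" and "s\<^sup>2 \<noteq> 1" and "q \<noteq> 1"
    and "inj_on u {1..m}"
    and "\<forall>i\<in>{1..m}. 1 - s * u i \<noteq> 0"
    and "\<forall>i\<in>{1..m}. u i - s * q \<noteq> 0"
  shows "D_op s q m k (F_sf s q m lam) u =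
         (if \<forall>j<k. lam (m - j) = int j then 1 else 0) * F_sf s q m lam u"
proof -
  have km: "k \<le> m" using assms(2) by simp
  have ss: "1 - s * s \<noteq> 0" using assms(6) by (simp add: power2_eq_square)
  note ne = assms(9)[rule_format]
  note neq = assms(10)[rule_format]
  note inj = strict_signature(2)[OF assms(3,4)]
  \<comment> \<open>Columns from \<open>N\<close> on stay empty; the summand \<open>m\<close> ensures that the columns \<open>0, ..., k - 1\<close>
    are among those considered.\<close>
  define N where "N = nat (lam 1) + Suc m"
  have lam: "\<forall>i\<in>{1..m}. 0 \<le> lam i \<and> lam i < int N"
  proof
    fix i assume i: "i \<in> {1..m}"
    have "0 \<le> lam i" using assms(3) i by (auto simp: Sign_plus_def)
    moreover have "lam i \<le> lam 1" using strict_signature(1)[OF assms(3,4), of 1 i] i by (cases "i = 1") auto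
    ultimately show "0 \<le> lam i \<and> lam i < int N" by (auto simp: N_def)
  qed
  define ns where "ns = map (\<lambda>x. card {i \<in> {1..m}. lam i = int x}) [0..<N]"
  have ns: "length ns = N" "\<And>x. x < N \<Longrightarrow> ns ! x = (if int x \<in> lam ` {1..m} then 1 else 0)"
  proof -
    fix x
    have "card {i \<in> {1..m}. lam i = y} = (if y \<in> lam ` {1..m} then 1 else 0)" for y
    proof (cases "y \<in> lam ` {1..m}")
      case True
      then obtain i where "i \<in> {1..m}" "lam i = y" by blast
      then have "{i \<in> {1..m}. lam i = y} = {i}" using inj by (auto dest: inj_onD)
      then show ?thesis using True by simp
    qed auto
    then show "x < N \<Longrightarrow> ns ! x = (if int x \<in> lam ` {1..m} then 1 else 0)" by (simp add: ns_def)
  qed (simp add: ns_def)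
  have Fu: "F_sf s q m lam v = occupation_F s q ns (map v [1..<Suc m])" if "\<And>j. j \<in> {1..m} \<Longrightarrow> 1 - s * v j \<noteq> 0" for v
    unfolding ns_def by (rule F_sf_eq[OF inj lam]) (use that in blast)
  let ?A = "{1..m}" and ?S = "{I. I \<subseteq> {1..m} \<and> card I = k}"
  define J where "J I = map u (sorted_list_of_set (?A - I))" for I
  define C where "C = F_stair s q k (\<lambda>_. s)"
  have C: "C = (\<Prod>i<k. (1 - q) / (1 - s * s) * ((s - s * q) / (1 - s * s)) ^ i)"
    using occupation_F_s_ones[OF ss, of q k "[]" "[]"] ss
    by (simp add: C_def F_stair_eq map_replicate_const occupation_F_def del: upt_Suc)
  have C0: "C \<noteq> 0" 
  proof -
    have "s - s * q \<noteq> 0" using assms(5,7) by simp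
    then show ?thesis unfolding C using ss assms(7) by auto
  qed
  \<comment> \<open>By symmetry the rows whose variables became \<open>s\<close> may be put at the bottom.\<close>
  have T: "T_prod s I (F_sf s q m lam) u = occupation_F s q ns (replicate k s @ J I)" if I: "I \<in> ?S" for I
  proof -
    let ?v = "\<lambda>i. if i \<in> I then s else u i"
    have fin: "finite I" using I finite_subset by blast
    have A: "mset_set ?A = mset_set I + mset_set (?A - I)"
      using I fin by (subst mset_set_Union[symmetric]) (auto intro: arg_cong[of _ _ mset_set])
    have "image_mset ?v (mset_set I) = replicate_mset k s"
    proof -
      have "image_mset ?v (mset_set I) = image_mset (\<lambda>_. s) (mset_set I)"
        by (rule image_mset_cong) (use fin in auto)
      then show ?thesis using I by (simp add: image_mset_const_eq)
    qed
    moreover have "image_mset ?v (mset_set (?A - I)) = image_mset u (mset_set (?A - I))"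
      by (rule image_mset_cong) auto
    ultimately have "mset (map ?v [1..<Suc m]) = mset (replicate k s @ J I)"
      unfolding mset_map mset_upto A by (simp add: J_def flip: sorted_list_of_mset_set)
    then have "occupation_F s q ns (map ?v [1..<Suc m]) = occupation_F s q ns (replicate k s @ J I)" by (rule occupation_F_permute)
    moreover have "F_sf s q m lam ?v = occupation_F s q ns (map ?v [1..<Suc m])"
      by (rule Fu) (use ne ss in auto)
    ultimately show ?thesis by (simp add: T_prod_eq[OF fin])
  qed
  have stair: "F_stair s q k (restrict_vars I u) = set_F s q (replicate k 1) u I" if "I \<in> ?S" for I
    by (rule F_stair_restrict) (use that ne finite_subset in auto)
  show ?thesis
  proof (cases "\<forall>j<k. lam (m - j) = int j")
    case True
    then have im: "int j \<in> lam ` ?A" if "j < k" for j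
      using staircase_iff[OF assms(3,4) km] that by blast
    define ns' where "ns' = drop k ns"
    have "take k ns = replicate k 1"
      by (rule nth_equalityI) (use im ns km in \<open>auto simp: N_def\<close>)
    then have ns': "ns = replicate k 1 @ ns'" by (metis append_take_drop_id ns'_def)
    have "D_op s q m k (F_sf s q m lam) u = (\<Sum>I\<in>?S.
      (\<Prod>i\<in>I. \<Prod>j\<in>?A - I. (u j - q * u i) / (u j - u i)) *
      (\<Prod>j\<in>?A - I. ((u j - s) / (1 - s * u j)) ^ k) *
      set_F s q (replicate k 1) u I * set_F s q ns' u (?A - I))"
      unfolding D_op_def
    proof (rule sum.cong[OF refl])
      fix I assume I: "I \<in> ?S"
      have "occupation_F s q ns (replicate k s @ J I) = C * (\<Prod>v\<leftarrow>J I. (v - s * q) / (1 - s * v)) ^ k * occupation_F s q ns' (J I)"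
        unfolding ns' C by (rule occupation_F_s_ones[OF ss])
      also have "(\<Prod>v\<leftarrow>J I. (v - s * q) / (1 - s * v)) = (\<Prod>j\<in>?A - I. (u j - s * q) / (1 - s * u j))"
        using prod.distinct_set_conv_list[of "sorted_list_of_set (?A - I)" "\<lambda>j. (u j - s * q) / (1 - s * u j)"]
        by (simp add: J_def o_def)
      also have "occupation_F s q ns' (J I) = set_F s q ns' u (?A - I)" by (simp add: set_F_def J_def)
      finally have 1: "T_prod s I (F_sf s q m lam) u =
        C * (\<Prod>j\<in>?A - I. ((u j - s * q) / (1 - s * u j)) ^ k) * set_F s q ns' u (?A - I)"
        by (simp add: T[OF I] prod_power_distrib)
      have "(\<Prod>j\<in>?A - I. ((u j - s) / (u j - s * q)) ^ k) * (\<Prod>j\<in>?A - I. ((u j - s * q) / (1 - s * u j)) ^ k)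
         = (\<Prod>j\<in>?A - I. ((u j - s) / (1 - s * u j)) ^ k)"
        unfolding prod.distrib[symmetric] power_mult_distrib[symmetric]
        by (rule prod.cong) (use neq in auto)
      then have 2: "(\<Prod>j\<in>?A - I. ((u j - s) / (1 - s * u j)) ^ k) =
         (\<Prod>j\<in>?A - I. ((u j - s) / (u j - s * q)) ^ k) * (\<Prod>j\<in>?A - I. ((u j - s * q) / (1 - s * u j)) ^ k)" ..
      have e: "a * b * (f / C) * (C * d * g) = a * (b * d) * f * g" for a b d f g
        using C0 by simp
      show "(\<Prod>i\<in>I. \<Prod>j\<in>?A - I. (u j - q * u i) / (u j - u i)) *
        (\<Prod>j\<in>?A - I. ((u j - s) / (u j - s * q)) ^ k) *
        (F_stair s q k (restrict_vars I u) / F_stair s q k (\<lambda>_. s)) * T_prod s I (F_sf s q m lam) u =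
       (\<Prod>i\<in>I. \<Prod>j\<in>?A - I. (u j - q * u i) / (u j - u i)) *
        (\<Prod>j\<in>?A - I. ((u j - s) / (1 - s * u j)) ^ k) *
        set_F s q (replicate k 1) u I * set_F s q ns' u (?A - I)"
        unfolding 1 2 stair[OF I] C_def[symmetric] by (rule e)
    qed
    also have "\<dots> = set_F s q ns u ?A"
      unfolding ns' by (rule set_F_split[symmetric]) (use assms(8) ne in auto)
    also have "\<dots> = occupation_F s q ns (map u [1..<Suc m])"
      by (rule set_F_eq[symmetric]) (simp_all only: mset_map mset_upto finite_atLeastAtMost)
    also have "\<dots> = F_sf s q m lam u" by (rule Fu[symmetric]) (rule ne)
    finally show ?thesis using True by simp
  next
    case False
    then obtain j0 where "j0 < k" "int j0 \<notin> lam ` ?A"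
      using staircase_iff[OF assms(3,4) km] by blast
    then obtain j where j: "j < k" "int j \<notin> lam ` ?A" "\<And>i. i < j \<Longrightarrow> int i \<in> lam ` ?A"
      using exists_least_iff[of "\<lambda>j. int j \<notin> lam ` ?A"] by (metis less_trans linorder_neqE_nat)
    have jN: "j < N" using j km by (simp add: N_def)
    have "take j ns = replicate j 1"
      by (rule nth_equalityI) (use j ns jN in auto)
    moreover have "drop j ns = 0 # drop (Suc j) ns"
      using Cons_nth_drop_Suc[of j ns] ns jN j(2) by simp
    ultimately have "ns = replicate j 1 @ 0 # drop (Suc j) ns" by (metis append_take_drop_id)
    then have "T_prod s I (F_sf s q m lam) u = 0" if "I \<in> ?S" for I
      using T[OF that] occupation_F_s_vanish[OF ss j(1)] by metis
    then have "D_op s q m k (F_sf s q m lam) u = 0" unfolding D_op_def by (intro sum.neutral) simp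
    then show ?thesis unfolding if_not_P[OF False] by simp
  qed
qed

end
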